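(* Let $X$ be a Banach space, and let $(T(t))_{t \in\mathbb R}$ be a $C_0$-group on $X$ with generator $A$, such that $\|T(t)\|\le C (1 + |t|^a)$ for all $t\in\mathbb R$, for some constant $C$ and exponent $a$. If $a \in [0,1)$, then for any closed $F\subset \mathbb R$, $$X(F)=\bigcap_{\beta \in \mathbb R \setminus F} \mathrm{ran}\, (i\beta-A)^{2}.$$ If $a \in [1,2)$, then for any closed $F\subset \mathbb R$, $$X(F)=\bigcap_{\beta \in \mathbb R \setminus F} \mathrm{ran}\, (i\beta-A)^{3}.$$
   Context: $X$ is a complex Banach space. $R(\lambda,A)=(\lambda-A)^{-1}$ is the resolvent of $A$; under the polynomial growth assumption on the group it is defined at least on $\mathbb C\setminus i\mathbb R$. The local spectrum $\sigma(x)$ of $x\in X$ is the complement of the set of points $\lambda_0\in\mathbb C$ such that the local resolvent $\lambda\mapsto R(\lambda,A)x$ is analytic in (i.e. extends analytically to) a neighborhood of $\lambda_0$. For closed $F\subset\mathbb R$, the spectral subspace is $X(F)=\{x\in X:\sigma(x)\subset iF\}$. $\mathrm{ran}$ denotes the range; $(i\beta-A)^n$ has its natural domain $\mathrm{dom}(A^n)$. The intersection over the empty index set (case $F=\mathbb R$) is $X$. *)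

theory Defs
  imports "HOL-Analysis.Analysis"
begin

class complex_banach = banach +
  fixes scaleC :: "complex \<Rightarrow> 'a \<Rightarrow> 'a"  (infixr "*\<^sub>C" 75)
  assumes scaleC_add_right: "c *\<^sub>C (x + y) = c *\<^sub>C x + c *\<^sub>C y"
    and scaleC_add_left: "(c + d) *\<^sub>C x = c *\<^sub>C x + d *\<^sub>C x"
    and scaleC_scaleC: "c *\<^sub>C d *\<^sub>C x = (c * d) *\<^sub>C x"
    and scaleC_of_real: "complex_of_real r *\<^sub>C x = r *\<^sub>R x"
    and norm_scaleC: "norm (c *\<^sub>C x) = cmod c * norm x"

instantiation complex :: complex_banach
begin

definition scaleC_complex :: "complex \<Rightarrow> complex \<Rightarrow> complex"
  where "scaleC_complex c x = c * x"

instance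
  by standard (simp_all add: scaleC_complex_def algebra_simps norm_mult scaleR_conv_of_real)

end

definition bounded_clinear :: "('a::complex_banach \<Rightarrow> 'a) \<Rightarrow> bool"
  where "bounded_clinear f \<longleftrightarrow> bounded_linear f \<and> (\<forall>c x. f (c *\<^sub>C x) = c *\<^sub>C f x)"

text \<open>The library's \<open>holomorphic_on\<close> only covers scalar-valued functions. As there, the notion is
  used on open sets, where complex differentiability is the same as analyticity.\<close>

definition vholomorphic_on :: "(complex \<Rightarrow> 'a::complex_banach) \<Rightarrow> complex set \<Rightarrow> bool"
    (infixl "vholomorphic'_on" 50)
  where "f vholomorphic_on U \<longleftrightarrow>
    (\<forall>z\<in>U. \<exists>D. (f has_derivative (\<lambda>h. h *\<^sub>C D)) (at z within U))"

text \<open>A partially defined operator is identified with its graph, a set of pairs \<open>(x, A x)\<close>. Then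
  \<open>Domain\<close> and \<open>Range\<close> are its domain and range, and the relation power \<open>A ^^ n\<close> is the
  \<open>n\<close>-th power of the operator with its natural domain.\<close>

definition shift :: "complex \<Rightarrow> ('a::complex_banach \<times> 'a) set \<Rightarrow> ('a \<times> 'a) set"
  \<comment> \<open>the operator \<open>\<mu> - A\<close>, on the domain of \<open>A\<close>\<close>
  where "shift \<mu> A = {(x, \<mu> *\<^sub>C x - y) | x y. (x, y) \<in> A}"

definition resolvent :: "complex \<Rightarrow> ('a::complex_banach \<times> 'a) set \<Rightarrow> 'a \<Rightarrow> 'a"
  where "resolvent \<mu> A y = (THE x. (x, y) \<in> shift \<mu> A)"

definition resolvent_set :: "('a::complex_banach \<times> 'a) set \<Rightarrow> complex set"
  where "resolvent_set A =
    {\<mu>. (\<forall>y. \<exists>!x. (x, y) \<in> shift \<mu> A) \<and> bounded_clinear (resolvent \<mu> A)}"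

text \<open>The extension \<open>f\<close> below has to agree with the local resolvent wherever the latter is defined
  in \<open>U\<close>; for the generators considered here this includes both sides of the imaginary axis.\<close>

definition local_spectrum :: "('a::complex_banach \<times> 'a) set \<Rightarrow> 'a \<Rightarrow> complex set"
  where "local_spectrum A x =
    - {\<mu>\<^sub>0. \<exists>U f. open U \<and> \<mu>\<^sub>0 \<in> U \<and> f vholomorphic_on U \<and>
          (\<forall>\<mu>\<in>U \<inter> resolvent_set A. f \<mu> = resolvent \<mu> A x)}"

definition spectral_subspace :: "('a::complex_banach \<times> 'a) set \<Rightarrow> real set \<Rightarrow> 'a set"
  where "spectral_subspace A F =
    {x. local_spectrum A x \<subseteq> (\<lambda>\<beta>. \<i> * complex_of_real \<beta>) ` F}"

definition C0_group :: "(real \<Rightarrow> 'a::complex_banach \<Rightarrow> 'a) \<Rightarrow> bool"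
  where "C0_group T \<longleftrightarrow>
    (\<forall>t. bounded_clinear (T t)) \<and>
    (\<forall>x. T 0 x = x) \<and>
    (\<forall>s t x. T (s + t) x = T s (T t x)) \<and>
    (\<forall>x. continuous_on UNIV (\<lambda>t. T t x))"

definition generator :: "(real \<Rightarrow> 'a::complex_banach \<Rightarrow> 'a) \<Rightarrow> ('a \<times> 'a) set"
  where "generator T = {(x, y). ((\<lambda>h. (T h x - x) /\<^sub>R h) \<longlongrightarrow> y) (at 0)}"

end

theory Submission imports Defs "HOL-Complex_Analysis.Complex_Analysis"
begin

text \<open>
  The group bound makes the Laplace transforms of the orbits converge off the imaginary axis, with
  \<open>norm (R(\<mu>)) \<le> M |Re \<mu>|^(-a-1)\<close> near the axis. Everything depends on comparing an integer \<open>n\<close> with this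
  exponent: for \<open>n > a + 1\<close> the spectral subspace of \<open>F\<close> is the intersection of the ranges of
  \<open>(i\<beta> - A)^n\<close>, \<open>\<beta> \<notin> F\<close> (\<open>spectral_subspace_eq_Inter_ranges\<close>), and the two cases of the theorem are
  \<open>n = 2\<close> and \<open>n = 3\<close>.

  One inclusion is algebraic and holds for every \<open>n\<close>. A holomorphic extension \<open>f\<close> of the local resolvent
  near \<open>i\<beta>\<close> solves \<open>(\<mu> - A) f(\<mu>) = x\<close>, because \<open>A\<close> is closed. Thus \<open>x = (i\<beta> - A) f(i\<beta>)\<close>, and the negative
  difference quotient of \<open>f\<close> at \<open>i\<beta>\<close> solves the same kind of equation for \<open>f(i\<beta>)\<close>, so the division
  can be repeated (\<open>range_power_if_solution\<close>).

  For the other inclusion, \<open>x = (i\<beta> - A)^n y\<close> gives \<open>R(\<mu>) x = (i\<beta> - \<mu>)^n R(\<mu>) y + p(\<mu>)\<close> with a polynomial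
  \<open>p\<close>, so \<open>R(i\<beta> + e) x\<close> has a limit as the real number \<open>e\<close> tends to 0, the same from both sides
  (\<open>radial_limit_of_range_power\<close>). These limits are pointwise in \<open>\<beta>\<close>, with no uniformity. The analytic
  core is \<open>vholomorphic_across_axis\<close>: a function that is holomorphic off the axis, grows at most
  polynomially at it, and has two-sided radial limits at all points of an open set of the axis, is
  holomorphic across that set. Were the set of singular points nonempty, Baire's theorem would give a
  portion of it with one bound for all radii. In the gaps between singular points the function is
  holomorphic, and a Phragmen-Lindelof argument, in which the two ends of a gap are the possible
  singularities (\<open>strip_bound\<close>), extends the bound from the edges to the strip over the gap. A segment near
  which the function is bounded is removable (\<open>holomorphic_across_axis\<close>), so the portion contains no
  singular point after all.

  The complex analysis in these arguments is applied to scalar functions \<open>\<phi> \<circ> g\<close>. Norming functionals, from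
  a short proof of the Hahn-Banach theorem by minimal sublinear functionals, transfer the estimates to
  the norm (\<open>norming_functional\<close>), and locally bounded weakly holomorphic functions are holomorphic
  (\<open>weakly_holomorphic_imp_vholomorphic\<close>).
\<close>

section \<open>Linear functionals below sublinear ones\<close>

definition sublinear :: "('a::real_vector \<Rightarrow> real) \<Rightarrow> bool"
  where "sublinear p \<longleftrightarrow>
    (\<forall>x y. p (x + y) \<le> p x + p y) \<and> (\<forall>c x. 0 \<le> c \<longrightarrow> p (c *\<^sub>R x) \<le> c * p x)"

lemma sublinear_add: "sublinear p \<Longrightarrow> p (x + y) \<le> p x + p y"
  by (simp add: sublinear_def)

lemma sublinear_scale_le: "sublinear p \<Longrightarrow> 0 \<le> c \<Longrightarrow> p (c *\<^sub>R x) \<le> c * p x"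
  by (simp add: sublinear_def)

lemma sublinear_zero: "sublinear p \<Longrightarrow> p 0 = 0"
  using sublinear_add[of p 0 0] sublinear_scale_le[of p 0 0] by simp

lemma sublinear_scale:
  assumes "sublinear p" "0 \<le> c" shows "p (c *\<^sub>R x) = c * p x"
proof (cases "c = 0")
  case True
  then show ?thesis using sublinear_zero[OF assms(1)] by simp
next
  case False
  then have c: "c > 0" using assms by simp
  have "p x \<le> inverse c * p (c *\<^sub>R x)"
    using sublinear_scale_le[OF assms(1), of "inverse c" "c *\<^sub>R x"] c by simp
  then have "c * p x \<le> p (c *\<^sub>R x)" using c by (simp add: field_simps)
  then show ?thesis using sublinear_scale_le[OF assms, of x] by simp
qed

lemma sublinear_neg_lower: "sublinear p \<Longrightarrow> - p (- x) \<le> p x"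
  using sublinear_add[of p x "- x"] sublinear_zero[of p] by simp

text \<open>\<open>drift p a\<close> is the largest sublinear functional below \<open>p\<close> that is affine with slope \<open>p a\<close> along the
  rays \<open>x + t a\<close>, \<open>t \<ge> 0\<close>. It produces linearity: a sublinear functional that is minimal for the
  pointwise order is fixed by every drift, and this says that it is additive.\<close>

definition drift :: "('a::real_vector \<Rightarrow> real) \<Rightarrow> 'a \<Rightarrow> 'a \<Rightarrow> real"
  where "drift p a x = (INF t\<in>{0..}. p (x + t *\<^sub>R a) - t * p a)"

text \<open>Subadditivity gives \<open>t p(a) \<le> p(x + t a) + p(-x)\<close>, so the infimum is a real number; without a lower
  bound the library's infimum would carry no information.\<close>

lemma drift_bdd:
  assumes "sublinear p" shows "bdd_below ((\<lambda>t. p (x + t *\<^sub>R a) - t * p a) ` {0..})"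
proof (rule bdd_belowI2[where m = "- p (- x)"])
  fix t :: real assume "t \<in> {0..}"
  then have "t * p a = p ((x + t *\<^sub>R a) + (- x))" using sublinear_scale[OF assms] by simp
  also have "\<dots> \<le> p (x + t *\<^sub>R a) + p (- x)" by (rule sublinear_add[OF assms])
  finally show "- p (- x) \<le> p (x + t *\<^sub>R a) - t * p a" by simp
qed

lemma drift_le: "sublinear p \<Longrightarrow> 0 \<le> t \<Longrightarrow> drift p a x \<le> p (x + t *\<^sub>R a) - t * p a"
  unfolding drift_def by (rule cINF_lower[OF drift_bdd]) auto

lemma drift_greatest:
  "(\<And>t. 0 \<le> t \<Longrightarrow> m \<le> p (x + t *\<^sub>R a) - t * p a) \<Longrightarrow> m \<le> drift p a x"
  unfolding drift_def by (rule cINF_greatest) auto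

lemma sublinear_drift:
  assumes "sublinear p" shows "sublinear (drift p a)"
  unfolding sublinear_def
proof (intro conjI allI impI)
  fix x y
  have "drift p a (x + y) - (p (x + s *\<^sub>R a) - s * p a) \<le> p (y + t *\<^sub>R a) - t * p a"
    if "0 \<le> s" "0 \<le> t" for s t
  proof -
    have "drift p a (x + y) \<le> p ((x + s *\<^sub>R a) + (y + t *\<^sub>R a)) - (s + t) * p a"
      using drift_le[OF assms, of "s + t" a "x + y"] that by (simp add: algebra_simps)
    also have "\<dots> \<le> p (x + s *\<^sub>R a) + p (y + t *\<^sub>R a) - (s + t) * p a"
      using sublinear_add[OF assms] by simp
    finally show ?thesis by (simp add: algebra_simps)
  qed
  then have "drift p a (x + y) - (p (x + s *\<^sub>R a) - s * p a) \<le> drift p a y" if "0 \<le> s" for s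
    using that by (intro drift_greatest) auto
  then have "drift p a (x + y) - drift p a y \<le> drift p a x"
    by (intro drift_greatest) (auto simp: algebra_simps)
  then show "drift p a (x + y) \<le> drift p a x + drift p a y" by simp
next
  fix c :: real and x assume c: "0 \<le> c"
  show "drift p a (c *\<^sub>R x) \<le> c * drift p a x"
  proof (cases "c = 0")
    case True
    then show ?thesis using drift_le[OF assms, of 0 a 0] sublinear_zero[OF assms] by simp
  next
    case False
    then have c: "c > 0" using c by simp
    have "drift p a (c *\<^sub>R x) / c \<le> p (x + t *\<^sub>R a) - t * p a" if "0 \<le> t" for t
    proof -
      have "drift p a (c *\<^sub>R x) \<le> p (c *\<^sub>R (x + t *\<^sub>R a)) - c * t * p a"
        using drift_le[OF assms, of "c * t" a "c *\<^sub>R x"] that c by (simp add: algebra_simps)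
      also have "\<dots> = c * (p (x + t *\<^sub>R a) - t * p a)"
        using sublinear_scale[OF assms, of c "x + t *\<^sub>R a"] c
        by (simp add: right_diff_distrib mult.assoc)
      finally show ?thesis using c by (simp add: field_simps)
    qed
    then have "drift p a (c *\<^sub>R x) / c \<le> drift p a x" by (rule drift_greatest)
    then show ?thesis using c by (simp add: field_simps)
  qed
qed

lemma drift_le_self: "sublinear p \<Longrightarrow> drift p a x \<le> p x"
  using drift_le[of p 0 a x] by simp

text \<open>The lower bounds that Zorn's lemma asks for. Along a chain the infimum is subadditive because two
  members that nearly attain it at \<open>x\<close> and at \<open>y\<close> can be replaced by the smaller of the two; it is
  finite because \<open>-p(-x)\<close> is a common lower bound.\<close>

lemma sublinear_INF_chain:
  fixes C :: "('a::real_vector \<Rightarrow> real) set"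
  assumes ne: "C \<noteq> {}" and sub: "\<And>q. q \<in> C \<Longrightarrow> sublinear q \<and> q \<le> p"
    and chain: "\<And>q r. q \<in> C \<Longrightarrow> r \<in> C \<Longrightarrow> q \<le> r \<or> r \<le> q"
  defines "u \<equiv> (\<lambda>x. INF q\<in>C. q x)"
  shows "sublinear u" and "\<And>q. q \<in> C \<Longrightarrow> u \<le> q"
proof -
  have "- p (- x) \<le> q x" if "q \<in> C" for q x
    using sublinear_neg_lower[of q x] sub[OF that] le_funD[of q p "- x"] by linarith
  then have bdd: "bdd_below ((\<lambda>q. q x) ` C)" for x by (intro bdd_belowI2)
  have le: "u x \<le> q x" if "q \<in> C" for q x
    unfolding u_def using bdd that by (rule cINF_lower)
  then show "\<And>q. q \<in> C \<Longrightarrow> u \<le> q" by (simp add: le_fun_def)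
  have ge: "m \<le> u x" if "\<And>q. q \<in> C \<Longrightarrow> m \<le> q x" for m x
    unfolding u_def using ne that by (rule cINF_greatest)
  show "sublinear u" unfolding sublinear_def
  proof (intro conjI allI impI)
    fix x y
    have "u (x + y) - q x \<le> r y" if "q \<in> C" "r \<in> C" for q r
    proof -
      have "\<exists>s\<in>C. s \<le> q \<and> s \<le> r" using chain[OF that] that by blast
      then obtain s where s: "s \<in> C" "s \<le> q" "s \<le> r" by blast
      have "u (x + y) \<le> s x + s y"
        using le[OF s(1)] sublinear_add[of s x y] sub[OF s(1)] order_trans by blast
      also have "\<dots> \<le> q x + r y" using s by (intro add_mono) (auto simp: le_fun_def)
      finally show ?thesis by simp
    qed
    then have "u (x + y) - q x \<le> u y" if "q \<in> C" for q using that by (intro ge)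
    then have "u (x + y) - u y \<le> u x" by (intro ge) (auto simp: algebra_simps)
    then show "u (x + y) \<le> u x + u y" by simp
  next
    fix c :: real and x assume c: "0 \<le> c"
    show "u (c *\<^sub>R x) \<le> c * u x"
    proof (cases "c = 0")
      case True
      obtain q where "q \<in> C" using ne by blast
      then show ?thesis using le[of q 0] sub[of q] sublinear_zero[of q] True by simp
    next
      case False
      then have c: "c > 0" using c by simp
      have "u (c *\<^sub>R x) / c \<le> q x" if "q \<in> C" for q
        using le[OF that, of "c *\<^sub>R x"] sublinear_scale[of q c x] sub[OF that] c
        by (simp add: field_simps)
      then have "u (c *\<^sub>R x) / c \<le> u x" by (rule ge)
      then show ?thesis using c by (simp add: field_simps)
    qed
  qed
qed

text \<open>The analytic Hahn-Banach theorem, in the form that needs no extension of partial functionals: a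
  minimal sublinear functional is linear, since minimality forces \<open>drift m a = m\<close>, that is
  \<open>m x + m a \<le> m (x + a)\<close>.\<close>

lemma linear_below_sublinear:
  fixes p :: "'a::real_vector \<Rightarrow> real"
  assumes p: "sublinear p"
  obtains f where "linear f" "f \<le> p"
proof -
  define S where "S = {q. sublinear q \<and> q \<le> p}"
  have "\<exists>m\<in>S. \<forall>q\<in>S. q \<le> m \<longrightarrow> q = m"
  proof (rule predicate_Zorn)
    show "partial_order_on S (relation_of (\<lambda>q r. r \<le> q) S)"
      by (auto simp: partial_order_on_def preorder_on_def refl_on_def trans_def antisym_def
          relation_of_def)
  next
    fix C assume C: "C \<in> Chains (relation_of (\<lambda>q r. r \<le> q) S)"
    show "\<exists>u\<in>S. \<forall>q\<in>C. u \<le> q"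
    proof (cases "C = {}")
      case True
      then show ?thesis using p by (auto simp: S_def)
    next
      case False
      have sub: "q \<in> C \<Longrightarrow> sublinear q \<and> q \<le> p" for q
        using C by (auto simp: Chains_def relation_of_def S_def)
      have chain: "q \<in> C \<Longrightarrow> r \<in> C \<Longrightarrow> q \<le> r \<or> r \<le> q" for q r
        using C by (auto simp: Chains_def relation_of_def)
      note inf = sublinear_INF_chain[OF False sub chain]
      obtain q where "q \<in> C" using False by blast
      then have "(\<lambda>x. INF q\<in>C. q x) \<le> p" using inf(2) sub order_trans by blast
      then have "(\<lambda>x. INF q\<in>C. q x) \<in> S" using inf(1) by (simp add: S_def)
      then show ?thesis using inf(2) by blast
    qed
  qed
  then obtain m where m: "m \<in> S" and min: "\<And>q. q \<in> S \<Longrightarrow> q \<le> m \<Longrightarrow> q = m" by blast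
  have sm: "sublinear m" and mp: "m \<le> p" using m by (auto simp: S_def)
  have drift: "drift m a = m" for a
  proof (rule min)
    show "drift m a \<le> m" using drift_le_self[OF sm] by (simp add: le_fun_def)
    then show "drift m a \<in> S" using sublinear_drift[OF sm] mp by (auto simp: S_def)
  qed
  have add: "m (x + a) = m x + m a" for x a
    using drift_le[OF sm, of 1 a x] sublinear_add[OF sm, of x a] drift[of a] by simp
  have neg: "m (- x) = - m x" for x
    using add[of x "- x"] sublinear_zero[OF sm] by simp
  have "m (c *\<^sub>R x) = c * m x" for c x
  proof (cases "0 \<le> c")
    case True
    then show ?thesis using sublinear_scale[OF sm] by blast
  next
    case False
    then show ?thesis using sublinear_scale[OF sm, of "- c" x] neg[of "c *\<^sub>R x"] by simp
  qed
  then have "linear m" using add by (intro linearI) auto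
  then show ?thesis using that mp by blast
qed

text \<open>Applied to the norm itself, minimality would not single out \<open>x\<^sub>0\<close>. Starting from the drift of the norm
  towards \<open>x\<^sub>0\<close> builds in the value \<open>-norm x\<^sub>0\<close> at \<open>-x\<^sub>0\<close>, which a linear functional must then attain.\<close>

lemma norming_real_functional:
  fixes x\<^sub>0 :: "'a::real_normed_vector"
  obtains f :: "'a \<Rightarrow> real" where "linear f" "\<And>x. f x \<le> norm x" "f x\<^sub>0 = norm x\<^sub>0"
proof -
  have sn: "sublinear (norm :: 'a \<Rightarrow> real)"
    by (simp add: sublinear_def norm_triangle_ineq)
  obtain f where f: "linear f" "f \<le> drift norm x\<^sub>0"
    using linear_below_sublinear[OF sublinear_drift[OF sn]] .
  have le: "f x \<le> norm x" for x
    using f(2) drift_le_self[OF sn, of x\<^sub>0 x] by (meson le_funD order_trans)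
  have "f (- x\<^sub>0) \<le> - norm x\<^sub>0"
    using drift_le[OF sn, of 1 x\<^sub>0 "- x\<^sub>0"] f(2) le_funD[of f "drift norm x\<^sub>0" "- x\<^sub>0"] by simp
  then have "f x\<^sub>0 = norm x\<^sub>0" using le[of x\<^sub>0] linear_neg[OF f(1), of x\<^sub>0] by simp
  then show ?thesis using that f(1) le by blast
qed

section \<open>Norming complex functionals\<close>

lemma scaleC_zero_left [simp]: "0 *\<^sub>C x = 0"
  using norm_scaleC[of 0 x] by simp

lemma scaleC_zero_right [simp]: "c *\<^sub>C 0 = 0"
  using norm_scaleC[of c 0] by simp

lemma scaleC_one [simp]: "1 *\<^sub>C x = x"
  using scaleC_of_real[of 1 x] by simp

lemma scaleC_minus_right [simp]: "c *\<^sub>C (- x) = - (c *\<^sub>C x)"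
  using scaleC_add_right[of c x "- x"] by (simp add: minus_unique)

lemma scaleC_minus_left [simp]: "(- c) *\<^sub>C x = - (c *\<^sub>C x)"
  using scaleC_add_left[of c "- c" x] by (simp add: minus_unique)

lemma scaleC_diff_right: "c *\<^sub>C (x - y) = c *\<^sub>C x - c *\<^sub>C y"
  using scaleC_add_right[of c x "- y"] by simp

lemma scaleC_diff_left: "(c - d) *\<^sub>C x = c *\<^sub>C x - d *\<^sub>C x"
  using scaleC_add_left[of c "- d" x] by simp

lemma bounded_bilinear_scaleC: "bounded_bilinear ((*\<^sub>C) :: complex \<Rightarrow> 'a::complex_banach \<Rightarrow> 'a)"
proof
  show "\<exists>K. \<forall>a (b::'a). norm (a *\<^sub>C b) \<le> norm a * norm b * K"
    by (rule exI[of _ 1]) (simp add: norm_scaleC)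
  fix r :: real and a :: complex and b :: 'a
  show "(r *\<^sub>R a) *\<^sub>C b = r *\<^sub>R a *\<^sub>C b"
    by (metis scaleC_of_real scaleC_scaleC scaleR_conv_of_real)
  show "a *\<^sub>C r *\<^sub>R b = r *\<^sub>R a *\<^sub>C b"
    by (metis mult.commute scaleC_of_real scaleC_scaleC)
qed (auto simp: scaleC_add_left scaleC_add_right)

definition contractive_functional :: "('a::complex_banach \<Rightarrow> complex) \<Rightarrow> bool"
  where "contractive_functional \<phi> \<longleftrightarrow>
    (\<forall>x y. \<phi> (x + y) = \<phi> x + \<phi> y) \<and> (\<forall>c x. \<phi> (c *\<^sub>C x) = c * \<phi> x) \<and>
    (\<forall>x. cmod (\<phi> x) \<le> norm x)"

lemma contractive_functional_add: "contractive_functional \<phi> \<Longrightarrow> \<phi> (x + y) = \<phi> x + \<phi> y"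
  and contractive_functional_scaleC: "contractive_functional \<phi> \<Longrightarrow> \<phi> (c *\<^sub>C x) = c * \<phi> x"
  and contractive_functional_le: "contractive_functional \<phi> \<Longrightarrow> cmod (\<phi> x) \<le> norm x"
  by (simp_all add: contractive_functional_def)

lemma contractive_functional_bounded_linear:
  assumes "contractive_functional \<phi>" shows "bounded_linear \<phi>"
proof (rule bounded_linear_intro[where K = 1])
  fix x y and r :: real
  show "\<phi> (x + y) = \<phi> x + \<phi> y" using assms by (rule contractive_functional_add)
  show "\<phi> (r *\<^sub>R x) = r *\<^sub>R \<phi> x"
    using contractive_functional_scaleC[OF assms, of "of_real r" x]
    by (simp add: scaleC_of_real scaleR_conv_of_real)
  show "norm (\<phi> x) \<le> norm x * 1" using contractive_functional_le[OF assms] by simp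
qed

text \<open>A real functional \<open>f\<close> is the real part of \<open>x \<mapsto> f x - i f (i x)\<close>. Rotating \<open>x\<close> by the phase of the
  value makes that value real, so the complex functional inherits the bound of \<open>f\<close>.\<close>

lemma norming_functional:
  fixes x\<^sub>0 :: "'a::complex_banach"
  obtains \<phi> where "contractive_functional \<phi>" "norm x\<^sub>0 \<le> cmod (\<phi> x\<^sub>0)"
proof -
  obtain f :: "'a \<Rightarrow> real" where f: "linear f" "\<And>x. f x \<le> norm x" "f x\<^sub>0 = norm x\<^sub>0"
    using norming_real_functional[of x\<^sub>0] by blast
  define \<phi> where "\<phi> x = Complex (f x) (- f (\<i> *\<^sub>C x))" for x
  have add: "\<phi> (x + y) = \<phi> x + \<phi> y" for x y
    by (simp add: \<phi>_def linear_add[OF f(1)] scaleC_add_right complex_eq_iff)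
  have I: "\<i> *\<^sub>C \<i> *\<^sub>C x = - x" for x :: 'a
    by (simp add: scaleC_scaleC)
  have split: "c *\<^sub>C x = Re c *\<^sub>R x + Im c *\<^sub>R (\<i> *\<^sub>C x)" for c and x :: 'a
    by (metis complex_eq mult.commute scaleC_add_left scaleC_of_real scaleC_scaleC)
  have R: "\<i> *\<^sub>C r *\<^sub>R x = r *\<^sub>R (\<i> *\<^sub>C x)" for r and x :: 'a
    by (metis mult.commute scaleC_of_real scaleC_scaleC)
  have scale: "\<phi> (c *\<^sub>C x) = c * \<phi> x" for c x
    unfolding split[of c x]
    by (simp add: \<phi>_def complex_eq_iff linear_add[OF f(1)] linear_scale[OF f(1)] linear_neg[OF f(1)]
        linear_diff[OF f(1)] scaleC_add_right R I)
  have "cmod (\<phi> x) \<le> norm x" for x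
  proof (cases "\<phi> x = 0")
    case False
    define c where "c = cnj (\<phi> x) / of_real (cmod (\<phi> x))"
    have c: "cmod c = 1" using False by (simp add: c_def norm_divide)
    have "\<phi> (c *\<^sub>C x) = of_real (cmod (\<phi> x))"
      using False complex_norm_square[of "\<phi> x"]
      by (simp add: scale c_def field_simps power2_eq_square)
    then have "cmod (\<phi> x) = f (c *\<^sub>C x)" by (metis Re_complex_of_real \<phi>_def complex.sel(1))
    also have "\<dots> \<le> norm x" using f(2)[of "c *\<^sub>C x"] c by (simp add: norm_scaleC)
    finally show ?thesis .
  qed simp
  then have "contractive_functional \<phi>" using add scale by (simp add: contractive_functional_def)
  moreover have "norm x\<^sub>0 \<le> cmod (\<phi> x\<^sub>0)"
    using complex_Re_le_cmod[of "\<phi> x\<^sub>0"] f(3) by (simp add: \<phi>_def)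
  ultimately show ?thesis using that by blast
qed

text \<open>The way in which scalar estimates are used below: a bound that holds for all contractive functionals,
  with the same constant, is a bound for the norm.\<close>

lemma norm_le_if_functionals_le:
  fixes x :: "'a::complex_banach"
  assumes "\<And>\<phi>. contractive_functional \<phi> \<Longrightarrow> cmod (\<phi> x) \<le> B"
  shows "norm x \<le> B"
  using norming_functional[of x] assms order_trans by metis

section \<open>Vector-valued holomorphy through functionals\<close>

text \<open>Differentiability at a single point, with no surrounding set: on an open set it is the same as
  holomorphy, and the statement can be moved freely between overlapping open sets.\<close>

definition vdiff_at :: "(complex \<Rightarrow> 'a::complex_banach) \<Rightarrow> complex \<Rightarrow> bool"
  where "vdiff_at g z \<longleftrightarrow> (\<exists>D. (g has_derivative (\<lambda>h. h *\<^sub>C D)) (at z))"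

lemma vholomorphic_on_open: "open U \<Longrightarrow> g vholomorphic_on U \<longleftrightarrow> (\<forall>z\<in>U. vdiff_at g z)"
  by (auto simp: vholomorphic_on_def vdiff_at_def at_within_open[of _ U])

lemma vdiff_at_imp_continuous: "vdiff_at g z \<Longrightarrow> isCont g z"
  unfolding vdiff_at_def using has_derivative_continuous by blast

lemma functional_has_field_derivative:
  assumes "(g has_derivative (\<lambda>h. h *\<^sub>C D)) (at z within U)" "contractive_functional \<phi>"
  shows "((\<lambda>z. \<phi> (g z)) has_field_derivative \<phi> D) (at z within U)"
  using bounded_linear.has_derivative[OF contractive_functional_bounded_linear[OF assms(2)] assms(1)]
  unfolding has_field_derivative_def
  by (simp add: contractive_functional_scaleC[OF assms(2)] mult.commute[of _ "\<phi> D"])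

lemma vholomorphic_imp_functional_holomorphic:
  "g vholomorphic_on U \<Longrightarrow> contractive_functional \<phi> \<Longrightarrow> (\<lambda>z. \<phi> (g z)) holomorphic_on U"
  unfolding holomorphic_on_def field_differentiable_def vholomorphic_on_def
  using functional_has_field_derivative by blast

text \<open>The constant depends on \<open>G\<close> only through its bound \<open>B\<close>. This uniformity allows the estimate
  to be used for \<open>\<phi> \<circ> g\<close> with all contractive \<open>\<phi>\<close> at once.\<close>

lemma holomorphic_second_order_bound:
  fixes G :: "complex \<Rightarrow> complex"
  assumes r: "r > 0" and hol: "G holomorphic_on ball z (3 * r)"
    and B: "\<And>w. w \<in> ball z (3 * r) \<Longrightarrow> cmod (G w) \<le> B" and h: "cmod h \<le> r"
  shows "cmod (G (z + h) - G z - h * deriv G z) \<le> 2 * B / r\<^sup>2 * (cmod h)\<^sup>2"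
proof -
  have sub: "cball z r \<subseteq> ball z (3 * r)" using r by auto
  have *: "cmod ((deriv ^^ 2) G w) \<le> 2 * B / r\<^sup>2" if "w \<in> cball z r" for w
  proof -
    have s: "cball w r \<subseteq> ball z (3 * r)"
    proof
      fix v assume "v \<in> cball w r"
      then have "dist z v \<le> r + r" using that dist_triangle[of z v w] by simp
      then show "v \<in> ball z (3 * r)" using r by simp
    qed
    have "cmod ((deriv ^^ 2) G w) \<le> fact 2 * B / r ^ 2"
    proof (rule Cauchy_inequality[OF _ _ r])
      show "G holomorphic_on ball w r" using hol s by (meson ball_subset_cball holomorphic_on_subset)
      show "continuous_on (cball w r) G"
        using hol s holomorphic_on_imp_continuous_on holomorphic_on_subset by blast
      show "cmod (G x) \<le> B" if "cmod (w - x) = r" for x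
        using that s by (intro B) (auto simp: dist_norm)
    qed
    then show ?thesis by (simp add: fact_numeral)
  qed
  have "cmod ((deriv ^^ 0) G (z + h) - (\<Sum>i\<le>1. (deriv ^^ i) G z * (z + h - z) ^ i / fact i))
      \<le> 2 * B / r\<^sup>2 * cmod (z + h - z) ^ Suc 1 / fact 1"
  proof (rule complex_Taylor)
    show "convex (cball z r)" by simp
    show "((deriv ^^ i) G has_field_derivative (deriv ^^ Suc i) G x) (at x within cball z r)"
      if "x \<in> cball z r" for i x
      using holomorphic_derivI[OF holomorphic_higher_deriv[OF hol open_ball] open_ball, of x i]
        that sub by (auto intro: has_field_derivative_at_within)
    show "cmod ((deriv ^^ Suc 1) G x) \<le> 2 * B / r\<^sup>2" if "x \<in> cball z r" for x
      using *[OF that] by (simp add: numeral_2_eq_2)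
    show "z \<in> cball z r" "z + h \<in> cball z r" using r h by (auto simp: dist_norm)
  qed
  then show ?thesis by (simp add: algebra_simps power2_eq_square)
qed

text \<open>For every contractive \<open>\<phi>\<close>, the difference quotient of \<open>\<phi> \<circ> g\<close> with increment \<open>h\<close> differs from the
  derivative by at most \<open>C |h|\<close>, with a constant that does not depend on \<open>\<phi>\<close>. Hence two
  difference quotients of \<open>g\<close> differ in norm by at most \<open>C (|h| + |k|)\<close>; by completeness they converge.\<close>

lemma weakly_holomorphic_imp_vholomorphic:
  fixes g :: "complex \<Rightarrow> 'a::complex_banach"
  assumes U: "open U"
    and bdd: "\<And>z. z \<in> U \<Longrightarrow> \<exists>r>0. \<exists>B. \<forall>w\<in>ball z r. norm (g w) \<le> B"
    and weak: "\<And>\<phi>. contractive_functional \<phi> \<Longrightarrow> (\<lambda>z. \<phi> (g z)) holomorphic_on U"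
  shows "g vholomorphic_on U"
  unfolding vholomorphic_on_open[OF U]
proof
  fix z assume z: "z \<in> U"
  obtain r1 B where r1: "r1 > 0" and B: "\<And>w. w \<in> ball z r1 \<Longrightarrow> norm (g w) \<le> B"
    using bdd[OF z] by blast
  obtain r2 where r2: "r2 > 0" "ball z r2 \<subseteq> U" using U z open_contains_ball by blast
  (* Derivatives are estimated on discs of radius r about points of cball z r; the factor 3 keeps these
     discs inside the region where g is bounded. *)
  define r where "r = min r1 r2 / 3"
  have r: "r > 0" using r1 r2 by (simp add: r_def)
  have br: "ball z (3 * r) \<subseteq> ball z r1" "ball z (3 * r) \<subseteq> U" using r2 by (auto simp: r_def)
  define C where "C = 2 * B / r\<^sup>2"
  define Q where "Q h = inverse h *\<^sub>C (g (z + h) - g z)" for h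
  have near: "cmod (\<phi> (Q h) - deriv (\<lambda>z. \<phi> (g z)) z) \<le> C * cmod h"
    if \<phi>: "contractive_functional \<phi>" and h: "h \<noteq> 0" "cmod h \<le> r" for \<phi> h
  proof -
    let ?G = "\<lambda>z. \<phi> (g z)"
    note lin = linear_diff[OF bounded_linear.linear[OF contractive_functional_bounded_linear[OF \<phi>]]]
    have "cmod (?G (z + h) - ?G z - h * deriv ?G z) \<le> C * (cmod h)\<^sup>2"
      unfolding C_def
    proof (rule holomorphic_second_order_bound[OF r _ _ h(2)])
      show "?G holomorphic_on ball z (3 * r)" using weak[OF \<phi>] br(2) holomorphic_on_subset by blast
      show "cmod (?G w) \<le> B" if "w \<in> ball z (3 * r)" for w
        using contractive_functional_le[OF \<phi>] B[of w] br(1) that order_trans by blast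
    qed
    moreover have "?G (z + h) - ?G z - h * deriv ?G z = h * (\<phi> (Q h) - deriv ?G z)"
      using h(1) by (simp add: Q_def contractive_functional_scaleC[OF \<phi>] lin field_simps)
    ultimately have "cmod (h * (\<phi> (Q h) - deriv ?G z)) \<le> C * (cmod h)\<^sup>2" by simp
    then have "cmod h * cmod (\<phi> (Q h) - deriv ?G z) \<le> cmod h * (C * cmod h)"
      by (simp only: norm_mult power2_eq_square mult.left_commute)
    then show ?thesis using h(1) by simp
  qed
  have cauchy: "norm (Q h - Q k) \<le> C * cmod h + C * cmod k"
    if hk: "h \<noteq> 0" "cmod h \<le> r" "k \<noteq> 0" "cmod k \<le> r" for h k
  proof (rule norm_le_if_functionals_le)
    fix \<phi> :: "'a \<Rightarrow> complex" assume \<phi>: "contractive_functional \<phi>"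
    note lin = linear_diff[OF bounded_linear.linear[OF contractive_functional_bounded_linear[OF \<phi>]]]
    show "cmod (\<phi> (Q h - Q k)) \<le> C * cmod h + C * cmod k"
      unfolding lin
      using near[OF \<phi> hk(1,2)] near[OF \<phi> hk(3,4)]
        norm_triangle_ineq4[of "\<phi> (Q h) - deriv (\<lambda>z. \<phi> (g z)) z" "\<phi> (Q k) - deriv (\<lambda>z. \<phi> (g z)) z"]
      by simp
  qed
  define s where "s n = complex_of_real (r * inverse (Suc n))" for n
  have s0: "s \<longlonglongrightarrow> 0"
  proof -
    have "(\<lambda>n. r * inverse (real (Suc n))) \<longlonglongrightarrow> r * 0"
      by (intro tendsto_mult tendsto_const LIMSEQ_inverse_real_of_nat)
    then show ?thesis unfolding s_def using tendsto_of_real[where 'a=complex] by fastforce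
  qed
  have s: "s n \<noteq> 0" "cmod (s n) \<le> r" for n
    using r unfolding s_def norm_of_real of_real_eq_0_iff by (auto simp: field_simps)
  have Cs: "(\<lambda>n. C * cmod (s n)) \<longlonglongrightarrow> 0"
    using tendsto_mult[OF tendsto_const[of C] tendsto_norm[OF s0]] by simp
  have "Cauchy (\<lambda>n. Q (s n))"
  proof (rule metric_CauchyI)
    fix e :: real assume "0 < e"
    then have "eventually (\<lambda>n. C * cmod (s n) < e / 2) sequentially"
      using order_tendstoD(2)[OF Cs, of "e/2"] by simp
    then obtain n0 where n0: "\<And>n. n \<ge> n0 \<Longrightarrow> C * cmod (s n) < e / 2"
      by (auto simp: eventually_sequentially)
    have "dist (Q (s m)) (Q (s n)) < e" if "m \<ge> n0" "n \<ge> n0" for m n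
      using cauchy[OF s s, of m n] n0[OF that(1)] n0[OF that(2)] by (simp add: dist_norm)
    then show "\<exists>M. \<forall>m\<ge>M. \<forall>n\<ge>M. dist (Q (s m)) (Q (s n)) < e" by blast
  qed
  then obtain D where D: "(\<lambda>n. Q (s n)) \<longlonglongrightarrow> D"
    using Cauchy_convergent convergent_def by blast
  have QD: "norm (Q h - D) \<le> C * cmod h" if "h \<noteq> 0" "cmod h \<le> r" for h
  proof (rule LIMSEQ_le)
    show "(\<lambda>n. norm (Q h - Q (s n))) \<longlonglongrightarrow> norm (Q h - D)" by (intro tendsto_intros D)
    show "(\<lambda>n. C * cmod h + C * cmod (s n)) \<longlonglongrightarrow> C * cmod h"
      using tendsto_add[OF tendsto_const Cs] by simp
    show "\<exists>N. \<forall>n\<ge>N. norm (Q h - Q (s n)) \<le> C * cmod h + C * cmod (s n)"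
      using cauchy[OF that s] by blast
  qed
  have "(g has_derivative (\<lambda>h. h *\<^sub>C D)) (at z)"
    unfolding has_derivative_at
  proof
    show "bounded_linear (\<lambda>h. h *\<^sub>C D)"
      by (rule bounded_bilinear.bounded_linear_left[OF bounded_bilinear_scaleC])
    show "(\<lambda>h. norm (g (z + h) - g z - h *\<^sub>C D) / norm h) \<midarrow>0\<rightarrow> 0"
    proof (rule Lim_null_comparison)
      have "norm (norm (g (z + h) - g z - h *\<^sub>C D) / norm h) \<le> C * cmod h"
        if h: "h \<noteq> 0" "cmod h < r" for h
      proof -
        have "g (z + h) - g z - h *\<^sub>C D = h *\<^sub>C (Q h - D)"
          using h(1) by (simp add: Q_def scaleC_diff_right scaleC_scaleC)
        then show ?thesis using QD[of h] h by (simp add: norm_scaleC)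
      qed
      then show "\<forall>\<^sub>F h in at 0. norm (norm (g (z + h) - g z - h *\<^sub>C D) / norm h) \<le> C * cmod h"
        unfolding eventually_at using r by (intro exI[of _ r]) (auto simp: dist_norm)
      show "((\<lambda>h. C * cmod h) \<longlongrightarrow> 0) (at 0)"
        by (rule tendsto_eq_intros | simp)+
    qed
  qed
  then show "vdiff_at g z" by (auto simp: vdiff_at_def)
qed

section \<open>Removing a segment of bounded discontinuity\<close>

text \<open>No continuity of \<open>G\<close> on the axis is assumed, only pointwise radial limits, so Morera's theorem does not
  apply to \<open>G\<close>. It applies to its primitives: the primitives on the two sides have bounded derivative,
  hence extend continuously to the segment, and there their difference is constant, because its
  increments are limits of integrals of \<open>G(e + iu) - G(-e + iu)\<close>, which vanish in the limit by
  dominated convergence. The two primitives therefore paste to one holomorphic function, and \<open>G\<close> is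
  its derivative.\<close>

lemma holomorphic_across_axis:
  fixes G :: "complex \<Rightarrow> complex"
  assumes hol: "G holomorphic_on {z. Re z \<noteq> 0}"
    and bdd: "\<And>e t. 0 < \<bar>e\<bar> \<Longrightarrow> \<bar>e\<bar> < 1 \<Longrightarrow> b < t \<Longrightarrow> t < c \<Longrightarrow> cmod (G (Complex e t)) \<le> K"
    and lim: "\<And>t. b < t \<Longrightarrow> t < c \<Longrightarrow> ((\<lambda>e. G (Complex e t)) \<longlongrightarrow> G (Complex 0 t)) (at 0)"
  shows "G holomorphic_on {z. \<bar>Re z\<bar> < 1 \<and> b < Im z \<and> Im z < c}"
proof (cases "b < c")
  case False
  then have "{z. \<bar>Re z\<bar> < 1 \<and> b < Im z \<and> Im z < c} = {}" by auto
  then show ?thesis by (simp only: holomorphic_on_empty)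
next
  case bc: True
  define S where "S = {z. \<bar>Re z\<bar> < 1 \<and> b < Im z \<and> Im z < c}"
  define P where "P = box (Complex 0 b) (Complex 1 c)"
  define N where "N = box (Complex (-1) b) (Complex 0 c)"
  have mem: "z \<in> P \<longleftrightarrow> 0 < Re z \<and> Re z < 1 \<and> b < Im z \<and> Im z < c"
    "z \<in> N \<longleftrightarrow> -1 < Re z \<and> Re z < 0 \<and> b < Im z \<and> Im z < c" for z
    by (auto simp: P_def N_def in_box_complex_iff)
  have "Complex (1/2) ((b + c) / 2) \<in> P" "Complex (-1/2) ((b + c) / 2) \<in> N"
    using bc by (auto simp: mem)
  then have clo: "closure P = cbox (Complex 0 b) (Complex 1 c)" "closure N = cbox (Complex (-1) b) (Complex 0 c)"
    unfolding P_def N_def by (metis closure_box empty_iff)+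
  have memc: "z \<in> closure P \<longleftrightarrow> 0 \<le> Re z \<and> Re z \<le> 1 \<and> b \<le> Im z \<and> Im z \<le> c"
    "z \<in> closure N \<longleftrightarrow> -1 \<le> Re z \<and> Re z \<le> 0 \<and> b \<le> Im z \<and> Im z \<le> c" for z
    by (auto simp: clo in_cbox_complex_iff)
  have prim: "\<exists>H h. (\<forall>z\<in>R. (H has_field_derivative G z) (at z)) \<and> uniformly_continuous_on (closure R) h
      \<and> (\<forall>z\<in>R. H z = h z)" if R: "open R" "convex R" "R \<subseteq> {z. Re z \<noteq> 0}" "R \<subseteq> S" for R
  proof -
    have holR: "G holomorphic_on R" using hol R(3) holomorphic_on_subset by blast
    obtain H where H: "\<And>z. z \<in> R \<Longrightarrow> (H has_field_derivative G z) (at z within R)"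
    proof (rule holomorphic_convex_primitive[OF R(2), of "{}" G])
      show "continuous_on R G" using holR by (rule holomorphic_on_imp_continuous_on)
      show "G field_differentiable at x" if "x \<in> interior R - {}" for x
        using holR R(1) that by (simp add: interior_open holomorphic_on_imp_differentiable_at)
    qed auto
    have "cmod (G z) \<le> K" if "z \<in> R" for z
    proof -
      have "z \<in> S" "Re z \<noteq> 0" using that R by auto
      then show ?thesis using bdd[of "Re z" "Im z"] by (simp add: S_def)
    qed
    then have GK: "\<And>z. z \<in> R \<Longrightarrow> cmod (G z) \<le> K" .
    have lip: "cmod (H x - H y) \<le> K * cmod (x - y)" if "x \<in> R" "y \<in> R" for x y
      by (rule field_differentiable_bound[OF R(2) H GK that])
    have uc: "uniformly_continuous_on R H"
    proof (rule lipschitz_on_uniformly_continuous)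
      show "\<bar>K\<bar>-lipschitz_on R H"
      proof (rule lipschitz_onI)
        fix x y assume "x \<in> R" "y \<in> R"
        then have "cmod (H x - H y) \<le> K * cmod (x - y)" by (rule lip)
        also have "\<dots> \<le> \<bar>K\<bar> * cmod (x - y)" by (intro mult_right_mono) auto
        finally show "dist (H x) (H y) \<le> \<bar>K\<bar> * dist x y" by (simp add: dist_norm)
      qed simp
    qed
    obtain h where "uniformly_continuous_on (closure R) h" "\<And>z. z \<in> R \<Longrightarrow> H z = h z"
    proof (rule uniformly_continuous_on_extension_on_closure[OF uc])
      fix h assume "uniformly_continuous_on (closure R) h" "\<And>z. z \<in> R \<Longrightarrow> H z = h z"
      then show thesis by (rule that)
    qed
    moreover have "(H has_field_derivative G z) (at z)" if "z \<in> R" for z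
      using H[OF that] unfolding at_within_open[OF that R(1)] .
    ultimately show ?thesis by (intro exI[of _ H] exI[of _ h] conjI ballI)
  qed
  have oc: "open P" "convex P" "open N" "convex N"
    by (auto simp: P_def N_def open_box)
  have sub: "P \<subseteq> {z. Re z \<noteq> 0}" "P \<subseteq> S" "N \<subseteq> {z. Re z \<noteq> 0}" "N \<subseteq> S"
    by (auto simp: mem S_def)
  obtain Hp hp where "\<forall>z\<in>P. (Hp has_field_derivative G z) (at z)"
    and hp: "uniformly_continuous_on (closure P) hp" and "\<forall>z\<in>P. Hp z = hp z"
    using prim[OF oc(1,2) sub(1,2)] by (elim exE conjE)
  then have Hp: "\<And>z. z \<in> P \<Longrightarrow> (Hp has_field_derivative G z) (at z)"
    and Hp_eq: "\<And>z. z \<in> P \<Longrightarrow> Hp z = hp z"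
    by simp_all
  obtain Hn hn where "\<forall>z\<in>N. (Hn has_field_derivative G z) (at z)"
    and hn: "uniformly_continuous_on (closure N) hn" and "\<forall>z\<in>N. Hn z = hn z"
    using prim[OF oc(3,4) sub(3,4)] by (elim exE conjE)
  then have Hn: "\<And>z. z \<in> N \<Longrightarrow> (Hn has_field_derivative G z) (at z)"
    and Hn_eq: "\<And>z. z \<in> N \<Longrightarrow> Hn z = hn z"
    by simp_all
  have chp: "continuous_on (closure P) hp" and chn: "continuous_on (closure N) hn"
    using hp hn uniformly_continuous_imp_continuous by auto
  \<comment> \<open>the jump between the two primitives across the segment\<close>
  define J where "J t = hp (Complex 0 t) - hn (Complex 0 t)" for t
  (* Two successors, so that e 0 lies below 1, inside the rectangles. *)
  define e where "e k = inverse (real (Suc (Suc k)))" for k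
  have e: "0 < e k" "e k < 1" for k by (auto simp: e_def field_simps)
  have e0: "e \<longlonglongrightarrow> 0" using LIMSEQ_Suc[OF LIMSEQ_inverse_real_of_nat] unfolding e_def .
  have Clim: "(\<lambda>k. Complex (e k) t) \<longlonglongrightarrow> Complex 0 t" "(\<lambda>k. Complex (- e k) t) \<longlonglongrightarrow> Complex 0 t" for t
    using tendsto_Complex[OF e0 tendsto_const] tendsto_Complex[OF tendsto_minus[OF e0] tendsto_const]
    by simp_all
  have J_le: "J t = J s" if st: "b < s" "s \<le> t" "t < c" for s t
  proof -
    define F where "F k u = \<i> * (G (Complex (e k) u) - G (Complex (- e k) u))" for k u
    define D where "D k u = Hp (Complex (e k) u) - Hn (Complex (- e k) u)" for k u
    have vd: "((\<lambda>u. H (Complex x u)) has_vector_derivative \<i> * G (Complex x u)) (at u within {s..t})"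
      if "(H has_field_derivative G (Complex x u)) (at (Complex x u))" for H x u
    proof -
      have *: "Complex x u = of_real x + \<i> * of_real u" for u by (simp add: complex_eq_iff)
      have "((\<lambda>u. of_real x + \<i> * of_real u) has_vector_derivative \<i>) (at u within {s..t})"
        by (auto intro!: derivative_eq_intros simp: has_vector_derivative_def scaleR_conv_of_real)
      from field_vector_diff_chain_within[OF this[folded *], of H "G (Complex x u)"] that
      show ?thesis unfolding * o_def by (metis has_field_derivative_at_within)
    qed
    have int: "(F k has_integral D k t - D k s) {s..t}" for k
    proof (rule fundamental_theorem_of_calculus[OF st(2)])
      fix u assume "u \<in> {s..t}"
      then have u: "b < u" "u < c" using st by auto
      have "((\<lambda>u. Hp (Complex (e k) u)) has_vector_derivative \<i> * G (Complex (e k) u)) (at u within {s..t})"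
        using Hp u e by (intro vd) (simp add: mem)
      moreover have "((\<lambda>u. Hn (Complex (- e k) u)) has_vector_derivative \<i> * G (Complex (- e k) u)) (at u within {s..t})"
        using Hn u e by (intro vd) (simp add: mem)
      ultimately show "(D k has_vector_derivative F k u) (at u within {s..t})"
        unfolding D_def F_def right_diff_distrib by (rule has_vector_derivative_diff)
    qed
    have "(\<lambda>k. integral {s..t} (F k)) \<longlonglongrightarrow> integral {s..t} (\<lambda>u. 0)"
    proof (rule dominated_convergence(2))
      show "F k integrable_on {s..t}" for k using int by blast
      show "(\<lambda>u. 2 * K) integrable_on {s..t}" by (rule integrable_const_ivl)
      show "norm (F k u) \<le> 2 * K" if "u \<in> {s..t}" for k u
        using norm_triangle_ineq4[of "G (Complex (e k) u)" "G (Complex (- e k) u)"]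
          bdd[of "e k" u] bdd[of "- e k" u] e[of k] st that by (simp add: F_def norm_mult)
      show "(\<lambda>k. F k u) \<longlonglongrightarrow> 0" if "u \<in> {s..t}" for u
      proof -
        have *: "(\<lambda>k. G (Complex (\<epsilon> k) u)) \<longlonglongrightarrow> G (Complex 0 u)"
          if "\<epsilon> \<longlonglongrightarrow> 0" "\<And>k. \<epsilon> k \<noteq> 0" for \<epsilon>
          by (rule filterlim_compose[OF lim]) (use that \<open>u \<in> {s..t}\<close> st in \<open>auto simp: filterlim_at\<close>)
        have "(\<lambda>k. F k u) \<longlonglongrightarrow> \<i> * (G (Complex 0 u) - G (Complex 0 u))"
          unfolding F_def using e e0 tendsto_minus[OF e0]
          by (intro tendsto_intros *) (auto simp: less_imp_neq order_less_imp_not_eq2)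
        then show ?thesis by simp
      qed
    qed
    moreover have "integral {s..t} (F k) = D k t - D k s" for k using int by (rule integral_unique)
    ultimately have 1: "(\<lambda>k. D k t - D k s) \<longlonglongrightarrow> 0" by simp
    have "(\<lambda>k. D k u) \<longlonglongrightarrow> J u" if u: "b < u" "u < c" for u
    proof -
      have "(\<lambda>k. hp (Complex (e k) u)) \<longlonglongrightarrow> hp (Complex 0 u)"
        using e u by (intro continuous_on_tendsto_compose[OF chp Clim(1)])
          (auto simp: memc less_imp_le)
      moreover have "(\<lambda>k. hn (Complex (- e k) u)) \<longlonglongrightarrow> hn (Complex 0 u)"
        using e u by (intro continuous_on_tendsto_compose[OF chn Clim(2)])
          (auto simp: memc less_imp_le)
      ultimately have "(\<lambda>k. hp (Complex (e k) u) - hn (Complex (- e k) u)) \<longlonglongrightarrow> J u"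
        unfolding J_def by (rule tendsto_diff)
      then show ?thesis using Hp_eq Hn_eq e u by (simp add: D_def mem)
    qed
    then have "(\<lambda>k. D k t - D k s) \<longlonglongrightarrow> J t - J s" using st by (intro tendsto_diff) auto
    then have "J t - J s = 0" using 1 by (rule LIMSEQ_unique)
    then show ?thesis by simp
  qed
  define c0 where "c0 = J ((b + c) / 2)"
  have J: "J t = c0" if "b < t" "t < c" for t
    using J_le[of t "(b+c)/2"] J_le[of "(b+c)/2" t] that by (cases "t \<le> (b+c)/2") (auto simp: c0_def)
  define H where "H z = (if Re z \<le> 0 then hn z + c0 else hp z)" for z
  have oS: "open S"
  proof -
    have "S = box (Complex (-1) b) (Complex 1 c)" by (auto simp: S_def in_box_complex_iff)
    then show ?thesis by (simp add: open_box)
  qed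
  have dH: "(H has_field_derivative G z) (at z)" if z: "z \<in> S" "Re z \<noteq> 0" for z
  proof (cases "Re z > 0")
    case True
    then have zP: "z \<in> P" using z by (auto simp: S_def mem)
    show ?thesis
      by (rule has_field_derivative_transform_within_open[OF Hp[OF zP] oc(1) zP])
        (auto simp: H_def mem Hp_eq)
  next
    case False
    then have zN: "z \<in> N" using z by (auto simp: S_def mem)
    then have "((\<lambda>z. Hn z + c0) has_field_derivative G z) (at z)"
      by (auto intro!: derivative_eq_intros Hn)
    then show ?thesis
      by (rule has_field_derivative_transform_within_open[OF _ oc(3) zN])
        (auto simp: H_def mem Hn_eq)
  qed
  have "H holomorphic_on S"
  proof (rule holomorphic_on_paste_across_line[OF oS, of 1 _ 0])
    have "H holomorphic_on S \<inter> {z. Re z \<noteq> 0}"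
      unfolding holomorphic_on_def field_differentiable_def
      using has_field_derivative_at_within[OF dH] by blast
    then show "H holomorphic_on S \<inter> {z. 1 \<bullet> z < 0}" "H holomorphic_on S \<inter> {z. 0 < 1 \<bullet> z}"
      by (rule holomorphic_on_subset, auto)+
    show "continuous_on S H" unfolding H_def
    proof (rule continuous_on_cases_le)
      show "continuous_on {z \<in> S. Re z \<le> 0} (\<lambda>z. hn z + c0)"
        by (intro continuous_intros continuous_on_subset[OF chn]) (auto simp: memc S_def)
      show "continuous_on {z \<in> S. 0 \<le> Re z} hp"
        by (intro continuous_on_subset[OF chp]) (auto simp: memc S_def)
      show "continuous_on S Re" by (intro continuous_intros)
      show "hn z + c0 = hp z" if "z \<in> S" "Re z = 0" for z
        using J[of "Im z"] that by (simp add: J_def S_def) (metis complex_surj diff_add_cancel add.commute)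
    qed
  qed simp
  then have hd: "deriv H holomorphic_on S" using oS holomorphic_deriv by blast
  have off: "deriv H z = G z" if "z \<in> S" "Re z \<noteq> 0" for z
    using dH[OF that] by (rule DERIV_imp_deriv)
  have "deriv H z = G z" if z: "z \<in> S" for z
  proof (cases "Re z = 0")
    case True
    define t where "t = Im z"
    have zt: "z = Complex 0 t" "b < t" "t < c" using z True by (auto simp: t_def S_def complex_eq_iff)
    have "isCont (deriv H) z"
      using hd oS z holomorphic_on_imp_continuous_on continuous_on_eq_continuous_at by blast
    moreover have "((\<lambda>e. Complex e t) \<longlongrightarrow> Complex 0 t) (at 0)" by (intro tendsto_intros)
    ultimately have 1: "((\<lambda>e. deriv H (Complex e t)) \<longlongrightarrow> deriv H z) (at 0)"
      unfolding zt by (metis isCont_tendsto_compose)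
    have "\<forall>\<^sub>F e in at 0. deriv H (Complex e t) = G (Complex e t)"
      unfolding eventually_at
      by (rule exI[of _ 1]) (use zt in \<open>auto intro!: off simp: S_def\<close>)
    from tendsto_cong[OF this] 1 have "((\<lambda>e. G (Complex e t)) \<longlongrightarrow> deriv H z) (at 0)" by blast
    then show ?thesis using lim[OF zt(2,3)] zt(1) tendsto_unique trivial_limit_at by blast
  qed (use off z in blast)
  then show ?thesis unfolding S_def[symmetric] using hd holomorphic_transform by blast
qed

section \<open>A maximum principle in strips with singular corners\<close>

text \<open>The growth hypothesis says nothing on the axis itself. On the circle of radius \<open>\<rho>\<close> about \<open>w\<close> one has
  \<open>|(v - w)\<^sup>2 + \<rho>\<^sup>2| = 2 \<rho> |Re v|\<close>, so the \<open>n\<close>-th power of this factor absorbs the blow-up of \<open>G\<close> at the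
  two points where the circle meets the axis, and the maximum principle carries the bound inside.\<close>

lemma disc_bound:
  fixes G :: "complex \<Rightarrow> complex"
  assumes \<rho>: "0 < \<rho>" "\<rho> \<le> 1" and w: "Re w = 0"
    and hol: "G holomorphic_on U" "cball w \<rho> \<subseteq> U"
    and growth: "\<And>z. \<bar>Re z\<bar> \<le> 1 \<Longrightarrow> \<bar>Re z\<bar> ^ n * cmod (G z) \<le> M"
    and z: "Im z = Im w" "\<bar>Re z\<bar> < \<rho>"
  shows "\<rho> ^ n * cmod (G z) \<le> 2 ^ n * M"
proof -
  define P where "P v = ((v - w)\<^sup>2 + of_real (\<rho>\<^sup>2)) ^ n * G v" for v
  have zw: "z - w = of_real (Re z)" using z(1) w by (simp add: complex_eq_iff)
  have "cmod (P z) \<le> (2 * \<rho>) ^ n * M"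
  proof (rule maximum_modulus_frontier[where f = P and S = "ball w \<rho>"])
    have holP: "P holomorphic_on cball w \<rho>"
      unfolding P_def using hol by (intro holomorphic_intros) (rule holomorphic_on_subset)
    then show "P holomorphic_on interior (ball w \<rho>)"
      by (rule holomorphic_on_subset) auto
    show "continuous_on (closure (ball w \<rho>)) P"
      using holP \<rho>(1) by (simp add: holomorphic_on_imp_continuous_on)
    show "z \<in> ball w \<rho>" using z(2) norm_of_real[of "Re z", where 'a=complex] unfolding zw[symmetric]
      by (simp add: dist_norm norm_minus_commute)
    fix v assume "v \<in> frontier (ball w \<rho>)"
    then have v: "cmod (v - w) = \<rho>" using \<rho>(1) by (simp add: dist_norm norm_minus_commute)
    have sq: "(Re v)\<^sup>2 + (Im v - Im w)\<^sup>2 = \<rho>\<^sup>2"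
      using v cmod_power2[of "v - w"] w by simp
    have "(v - w)\<^sup>2 + of_real (\<rho>\<^sup>2) = of_real (2 * Re v) * (v - w)"
      unfolding sq[symmetric] using w by (simp add: complex_eq_iff power2_eq_square algebra_simps)
    then have "cmod ((v - w)\<^sup>2 + of_real (\<rho>\<^sup>2)) = 2 * \<rho> * \<bar>Re v\<bar>"
      using v by (simp only: norm_mult norm_of_real) (simp add: abs_mult)
    then have "cmod (P v) = (2 * \<rho>) ^ n * (\<bar>Re v\<bar> ^ n * cmod (G v))"
      by (simp only: P_def norm_mult norm_power power_mult_distrib mult.assoc)
    also have "\<dots> \<le> (2 * \<rho>) ^ n * M"
    proof (intro mult_left_mono growth)
      show "\<bar>Re v\<bar> \<le> 1" using abs_Re_le_cmod[of "v - w"] v w \<rho> by simp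
    qed (use \<rho> in simp)
    finally show "cmod (P v) \<le> (2 * \<rho>) ^ n * M" .
  qed auto
  moreover have "cmod (P z) = (\<rho>\<^sup>2 + (Re z)\<^sup>2) ^ n * cmod (G z)"
  proof -
    have "(z - w)\<^sup>2 + of_real (\<rho>\<^sup>2) = complex_of_real (\<rho>\<^sup>2 + (Re z)\<^sup>2)" by (simp add: zw)
    then show ?thesis unfolding P_def norm_mult norm_power by (metis abs_of_nonneg norm_of_real sum_power2_ge_zero)
  qed
  moreover have "(\<rho>\<^sup>2) ^ n * cmod (G z) \<le> (\<rho>\<^sup>2 + (Re z)\<^sup>2) ^ n * cmod (G z)"
    by (intro mult_right_mono power_mono) auto
  ultimately have "\<rho> ^ n * (\<rho> ^ n * cmod (G z)) \<le> \<rho> ^ n * (2 ^ n * M)"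
    by (simp add: power2_eq_square power_mult_distrib mult_ac)
  then show ?thesis using \<rho>(1) by simp
qed

text \<open>The disc estimate turns growth in terms of the distance to the axis into growth in terms of the
  distance \<open>d\<close> to the edges of the strip. For \<open>|Re z| \<ge> d / 2\<close> the hypothesis suffices; otherwise a disc of
  radius \<open>d / 2\<close> about the projection of \<open>z\<close> to the axis fits into the domain of \<open>G\<close>.\<close>

lemma strip_bound_near_axis:
  fixes G :: "complex \<Rightarrow> complex"
  assumes hol: "G holomorphic_on {z. Re z \<noteq> 0 \<or> (b < Im z \<and> Im z < c)}"
    and growth: "\<And>z. \<bar>Re z\<bar> \<le> 1 \<Longrightarrow> \<bar>Re z\<bar> ^ n * cmod (G z) \<le> M"
    and z: "\<bar>Re z\<bar> \<le> 1" "0 \<le> d" "d \<le> 1" "d \<le> Im z - b" "d \<le> c - Im z" and "0 < n"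
  shows "d ^ n * cmod (G z) \<le> 4 ^ n * M"
proof (cases "d = 0")
  case True
  have "0 \<le> M" using growth[of 0] \<open>0 < n\<close> by (simp add: zero_power)
  then show ?thesis using True \<open>0 < n\<close> by (simp add: zero_power)
next
  case False
  then have d: "d > 0" using z by simp
  have "(d / 2) ^ n * cmod (G z) \<le> 2 ^ n * M"
  proof (cases "\<bar>Re z\<bar> < d / 2")
    case True
    show ?thesis
    proof (rule disc_bound[where w = "Complex 0 (Im z)", OF _ _ _ hol _ growth])
      show "cball (Complex 0 (Im z)) (d / 2) \<subseteq> {z. Re z \<noteq> 0 \<or> b < Im z \<and> Im z < c}"
      proof
        fix v assume "v \<in> cball (Complex 0 (Im z)) (d / 2)"
        then have "\<bar>Im z - Im v\<bar> \<le> d / 2"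
          using abs_Im_le_cmod[of "Complex 0 (Im z) - v"] by (simp add: dist_norm)
        then have "Im z - Im v \<le> d / 2" "Im v - Im z \<le> d / 2" by linarith+
        then show "v \<in> {z. Re z \<noteq> 0 \<or> b < Im z \<and> Im z < c}" using z d by auto
      qed
    qed (use True d z in auto)
  next
    case False
    have M: "0 \<le> M" using growth[of 0] \<open>0 < n\<close> by (simp add: zero_power)
    have "(d / 2) ^ n * cmod (G z) \<le> \<bar>Re z\<bar> ^ n * cmod (G z)"
      using False d by (intro mult_right_mono power_mono) auto
    also have "\<dots> \<le> M" using growth z(1) by simp
    also have "\<dots> \<le> 2 ^ n * M" using M mult_right_mono[of 1 "2^n" M] by simp
    finally show ?thesis .
  qed
  then have "2 ^ n * ((d / 2) ^ n * cmod (G z)) \<le> 2 ^ n * (2 ^ n * M)" by simp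
  moreover have "2 ^ n * (d / 2) ^ n = d ^ n" by (simp flip: power_mult_distrib)
  moreover have "2 ^ n * (2 ^ n * M) = 4 ^ n * M" by (simp flip: power_mult_distrib mult.assoc)
  ultimately show ?thesis by (metis mult.assoc)
qed

text \<open>The distance to a corner is at most twice the larger of the distance to the axis and the distance
  to the edge, and \<open>G\<close> is controlled by either of them.\<close>

lemma corner_growth:
  fixes G :: "complex \<Rightarrow> complex"
  assumes hol: "G holomorphic_on {z. Re z \<noteq> 0 \<or> (b < Im z \<and> Im z < c)}"
    and growth: "\<And>z. \<bar>Re z\<bar> \<le> 1 \<Longrightarrow> \<bar>Re z\<bar> ^ n * cmod (G z) \<le> M" and n: "0 < n"
    and p: "p = b \<or> p = c"
    and z: "\<bar>Re z\<bar> \<le> 1" "b \<le> Im z" "Im z \<le> c" "\<bar>Im z - p\<bar> \<le> min 1 ((c - b) / 2)"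
  shows "cmod (z - Complex 0 p) ^ n * cmod (G z) \<le> 8 ^ n * M"
proof -
  define m where "m = max \<bar>Re z\<bar> \<bar>Im z - p\<bar>"
  have M: "0 \<le> M" using growth[of 0] n by (simp add: zero_power)
  have dn: "\<bar>Im z - p\<bar> ^ n * cmod (G z) \<le> 4 ^ n * M"
  proof (rule strip_bound_near_axis[OF hol growth z(1) _ _ _ _ n])
    show "\<bar>Im z - p\<bar> \<le> Im z - b" "\<bar>Im z - p\<bar> \<le> c - Im z"
      using p z by (auto simp: abs_if min_def split: if_splits)
  qed (use z in auto)
  have re: "\<bar>Re z\<bar> ^ n * cmod (G z) \<le> 4 ^ n * M"
    by (rule order_trans[OF growth[OF z(1)]]) (use M mult_right_mono[of 1 "4^n" M] in simp)
  have "cmod (z - Complex 0 p) \<le> 2 * m"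
    using cmod_le[of "z - Complex 0 p"] by (auto simp: m_def max_def)
  then have "cmod (z - Complex 0 p) ^ n * cmod (G z) \<le> (2 * m) ^ n * cmod (G z)"
    by (intro mult_right_mono power_mono) auto
  also have "\<dots> = 2 ^ n * (m ^ n * cmod (G z))" by (simp add: power_mult_distrib)
  also have "\<dots> \<le> 2 ^ n * (4 ^ n * M)" using dn re by (intro mult_left_mono) (auto simp: m_def max_def)
  also have "\<dots> = 8 ^ n * M" by (simp flip: power_mult_distrib mult.assoc)
  finally show ?thesis .
qed

text \<open>A Phragmen-Lindelof argument. The corners \<open>ib\<close> and \<open>ic\<close> may be singular points of \<open>G\<close>, but only of
  polynomial order \<open>n\<close>. For \<open>k > 0\<close> the quotient \<open>q k\<close> has modulus at most 1 in the strip, vanishes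
  at the corners, and tends to 1 elsewhere as \<open>k \<rightarrow> 0\<close>. So the maximum principle applies to
  \<open>q k ^ (n + 1) G\<close>, which is continuous up to the corners, and \<open>k \<rightarrow> 0\<close> gives the bound for \<open>G\<close>.\<close>

lemma strip_bound:
  fixes G :: "complex \<Rightarrow> complex"
  assumes hol: "G holomorphic_on {z. Re z \<noteq> 0 \<or> (b < Im z \<and> Im z < c)}"
    and growth: "\<And>z. \<bar>Re z\<bar> \<le> 1 \<Longrightarrow> \<bar>Re z\<bar> ^ n * cmod (G z) \<le> M" and n: "0 < n"
    and lines: "\<And>e p. e \<noteq> 0 \<Longrightarrow> \<bar>e\<bar> \<le> 1 \<Longrightarrow> p = b \<or> p = c \<Longrightarrow> cmod (G (Complex e p)) \<le> K"
    and MK: "M \<le> K" and z: "\<bar>Re z\<bar> < 1" "b < Im z" "Im z < c"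
  shows "cmod (G z) \<le> K"
proof -
  have M: "0 \<le> M" using growth[of 0] n by (simp add: zero_power)
  define R where "R = box (Complex (-1) b) (Complex 1 c)"
  have memR: "v \<in> R \<longleftrightarrow> -1 < Re v \<and> Re v < 1 \<and> b < Im v \<and> Im v < c" for v
    by (auto simp: R_def in_box_complex_iff)
  have zR: "z \<in> R" using z by (auto simp: memR)
  then have clo: "closure R = cbox (Complex (-1) b) (Complex 1 c)"
    unfolding R_def by (metis closure_box empty_iff)
  have memC: "v \<in> closure R \<longleftrightarrow> -1 \<le> Re v \<and> Re v \<le> 1 \<and> b \<le> Im v \<and> Im v \<le> c" for v
    by (auto simp: clo in_cbox_complex_iff)
  have oR: "open R" by (simp add: R_def open_box)
  define q where "q k v = ((v - Complex 0 b) * (v - Complex 0 c)) /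
      ((v - Complex 0 (b - k)) * (v - Complex 0 (c + k)))" for k v
  have bound: "cmod (q k z ^ Suc n * G z) \<le> K" if k: "0 < k" for k
  proof -
    (* The poles of q lie at distance k below and above the strip. *)
    have far: "k \<le> cmod (v - Complex 0 (b - k))" "k \<le> cmod (v - Complex 0 (c + k))"
      if "v \<in> closure R" for v
      using abs_Im_le_cmod[of "v - Complex 0 (b - k)"] abs_Im_le_cmod[of "v - Complex 0 (c + k)"]
        that k by (auto simp: memC)
    have ne: "v - Complex 0 (b - k) \<noteq> 0" "v - Complex 0 (c + k) \<noteq> 0" if "v \<in> closure R" for v
      using far[OF that] k by auto
    have le: "cmod (v - Complex 0 b) \<le> cmod (v - Complex 0 (b - k))"
      "cmod (v - Complex 0 c) \<le> cmod (v - Complex 0 (c + k))" if "v \<in> closure R" for v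
      using that k by (auto simp: memC cmod_def intro!: real_sqrt_le_mono power2_le_imp_le
          simp flip: abs_le_square_iff)
    have q1: "cmod (q k v) \<le> 1" if "v \<in> closure R" for v
    proof -
      have "cmod (v - Complex 0 b) * cmod (v - Complex 0 c) \<le>
          cmod (v - Complex 0 (b - k)) * cmod (v - Complex 0 (c + k))"
        by (intro mult_mono le that) auto
      then show ?thesis
        unfolding q_def norm_divide norm_mult using ne[OF that]
        by (intro divide_le_eq_1[THEN iffD2]) auto
    qed
    have q2: "cmod (q k v) \<le> cmod (v - Complex 0 p) / k" if v: "v \<in> closure R" and p: "p = b \<or> p = c" for v p
    proof -
      have *: "x * y / (X * Y) \<le> x / k" "y * x / (Y * X) \<le> x / k"
        if "0 \<le> x" "0 \<le> y" "y \<le> Y" "k \<le> X" for x y X Y :: real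
      proof -
        have "x * y / (X * Y) = (x / X) * (y / Y)" by simp
        also have "\<dots> \<le> (x / X) * 1"
          using that k by (intro mult_left_mono) (auto simp: divide_le_eq_1)
        also have "\<dots> \<le> x / k" using that k by (simp add: frac_le)
        finally show "x * y / (X * Y) \<le> x / k" .
        then show "y * x / (Y * X) \<le> x / k" by (simp add: mult.commute)
      qed
      show ?thesis
        unfolding q_def norm_divide norm_mult using p le[OF v] far[OF v] by (auto intro!: *)
    qed
    define P where "P v = q k v ^ Suc n * G v" for v
    have cont_at: "continuous (at v within closure R) P" if v: "v \<in> closure R" for v
    proof (cases "Re v \<noteq> 0 \<or> (b < Im v \<and> Im v < c)")
      case True
      have "open ({z. Re z \<noteq> 0} \<union> {z. b < Im z \<and> Im z < c})"
        by (intro open_Un open_Collect_neq open_Collect_conj open_Collect_less continuous_intros)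
      then have "open {z. Re z \<noteq> 0 \<or> (b < Im z \<and> Im z < c)}" by (simp only: Collect_disj_eq)
      then have "isCont G v"
        using hol True by (metis (mono_tags, lifting) continuous_on_eq_continuous_at
            holomorphic_on_imp_continuous_on mem_Collect_eq)
      then have "isCont P v" unfolding P_def q_def using ne[OF v] by (intro continuous_intros) auto
      then show ?thesis by (rule continuous_at_imp_continuous_at_within)
    next
      case False
      then obtain p where p: "p = b \<or> p = c" "v = Complex 0 p"
        using v by (auto simp: memC complex_eq_iff)
      have Pv: "P v = 0" using p by (auto simp: P_def q_def)
      define \<delta> where "\<delta> = min 1 ((c - b) / 2)"
      have \<delta>: "\<delta> > 0" using z by (simp add: \<delta>_def)
      (* One of the n + 1 factors q is left over after the others have cancelled the growth of G. *)
      have le: "cmod (P u) \<le> 8 ^ n * M / k ^ Suc n * cmod (u - v)"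
        if u: "u \<in> closure R" "dist u v < \<delta>" for u
      proof -
        have "\<bar>Im u - p\<bar> \<le> \<delta>" using abs_Im_le_cmod[of "u - v"] u p by (simp add: dist_norm)
        then have cg: "cmod (u - v) ^ n * cmod (G u) \<le> 8 ^ n * M"
          unfolding p(2) using u by (intro corner_growth[OF hol growth n p(1)]) (auto simp: memC \<delta>_def)
        have "cmod (P u) = cmod (q k u) ^ Suc n * cmod (G u)"
          by (simp add: P_def norm_mult norm_power)
        also have "\<dots> \<le> (cmod (u - v) / k) ^ Suc n * cmod (G u)"
          using q2[OF u(1) p(1)] p(2) by (intro mult_right_mono power_mono) auto
        also have "\<dots> = cmod (u - v) / k ^ Suc n * (cmod (u - v) ^ n * cmod (G u))"
          by (simp add: power_divide)
        also have "\<dots> \<le> cmod (u - v) / k ^ Suc n * (8 ^ n * M)"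
          using cg k by (intro mult_left_mono) auto
        finally show ?thesis by (simp add: mult.commute)
      qed
      have "(P \<longlongrightarrow> 0) (at v within closure R)"
      proof (rule Lim_null_comparison)
        show "\<forall>\<^sub>F u in at v within closure R. norm (P u) \<le> 8 ^ n * M / k ^ Suc n * cmod (u - v)"
          unfolding eventually_at using le \<delta> by blast
        have "((\<lambda>u. 8 ^ n * M / k ^ Suc n * cmod (u - v)) \<longlongrightarrow> 8 ^ n * M / k ^ Suc n * cmod (v - v))
            (at v within closure R)" by (intro tendsto_intros)
        then show "((\<lambda>u. 8 ^ n * M / k ^ Suc n * cmod (u - v)) \<longlongrightarrow> 0) (at v within closure R)"
          by simp
      qed
      then show ?thesis by (simp add: continuous_within Pv)
    qed
    have "cmod (P z) \<le> K"
    proof (rule maximum_modulus_frontier[where f = P and S = R])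
      show "P holomorphic_on interior R"
        unfolding P_def q_def interior_open[OF oR]
      proof (intro holomorphic_intros)
        show "G holomorphic_on R" using hol by (rule holomorphic_on_subset) (auto simp: memR)
        show "(v - Complex 0 (b - k)) * (v - Complex 0 (c + k)) \<noteq> 0" if "v \<in> R" for v
          using ne[of v] that closure_subset by auto
      qed
      show "continuous_on (closure R) P"
        using cont_at by (simp add: continuous_on_eq_continuous_within)
      show "bounded R" by (simp add: R_def)
      show "z \<in> R" by (rule zR)
      fix v assume "v \<in> frontier R"
      then have v: "v \<in> closure R" "v \<notin> R" using interior_open[OF oR] by (auto simp: frontier_def)
      have PG: "cmod (P v) \<le> cmod (G v)"
      proof -
        have "cmod (P v) = cmod (q k v) ^ Suc n * cmod (G v)" by (simp add: P_def norm_mult norm_power)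
        also have "\<dots> \<le> 1 * cmod (G v)"
          using q1[OF v(1)] by (intro mult_right_mono power_le_one) auto
        finally show ?thesis by simp
      qed
      have "Re v = -1 \<or> Re v = 1 \<or> Im v = b \<or> Im v = c" using v by (auto simp: memR memC)
      then consider "Re v = -1 \<or> Re v = 1" | "v = Complex 0 b \<or> v = Complex 0 c"
        | "Im v = b \<or> Im v = c" "Re v \<noteq> 0"
        by (cases "Re v = 0") (auto simp: complex_eq_iff)
      then show "cmod (P v) \<le> K"
      proof cases
        case 1
        then show ?thesis using growth[of v] MK PG by auto
      next
        case 2
        then have "P v = 0" by (auto simp: P_def q_def)
        then show ?thesis using M MK by simp
      next
        case 3
        have "cmod (G (Complex (Re v) (Im v))) \<le> K" using 3 v by (intro lines) (auto simp: memC)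
        then show ?thesis using PG by simp
      qed
    qed
    then show ?thesis by (simp add: P_def)
  qed
  define s where "s i = inverse (real (Suc i))" for i
  have s: "s \<longlonglongrightarrow> 0" "\<And>i. 0 < s i" unfolding s_def by (rule LIMSEQ_inverse_real_of_nat) simp
  have ne: "z - Complex 0 b \<noteq> 0" "z - Complex 0 c \<noteq> 0" using z by (auto simp: complex_eq_iff)
  have lim: "(\<lambda>i. cmod (q (s i) z ^ Suc n * G z)) \<longlonglongrightarrow> cmod (q 0 z ^ Suc n * G z)"
    unfolding q_def using ne by (intro tendsto_intros s) auto
  have "cmod (q 0 z ^ Suc n * G z) \<le> K"
    by (rule LIMSEQ_le_const2[OF lim]) (use bound s in blast)
  then show ?thesis using ne by (simp add: q_def)
qed

section \<open>Extension from radial limits\<close>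

text \<open>Baire's theorem for the locally closed set \<open>J - W\<close>: if countably many closed sets cover it, one of them
  contains all of its points in some interval.\<close>

lemma Baire_portion:
  fixes J W :: "real set" and S :: "nat \<Rightarrow> real set"
  assumes J: "open J" and W: "open W" and ne: "J - W \<noteq> {}"
    and S: "\<And>N. closed (S N)" and cover: "J - W \<subseteq> (\<Union>N. S N)"
  obtains p d N where "p \<in> J - W" "d > 0" "ball p d \<subseteq> J" "(J - W) \<inter> ball p d \<subseteq> S N"
proof -
  define E where "E = J - W"
  obtain e where e: "e \<in> E" using ne by (auto simp: E_def)
  obtain r where r: "r > 0" "cball e r \<subseteq> J" using J e by (auto simp: E_def open_contains_cball)
  (* A closed subset of E. Taking the closure of an open portion, and not E intersected with a closed
     interval, guarantees that every relatively open part of T meets the open portion. *)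
  define T where "T = closure (E \<inter> ball e r)"
  have "T \<subseteq> cball e r" unfolding T_def by (rule closure_minimal) auto
  moreover have "T \<subseteq> - W" unfolding T_def by (rule closure_minimal) (use W in \<open>auto simp: E_def closed_Compl\<close>)
  ultimately have TE: "T \<subseteq> E" using r by (auto simp: E_def)
  have eT: "e \<in> T" unfolding T_def using e r by (intro closure_subset[THEN subsetD]) auto
  have "\<exists>N. \<not> T \<subseteq> closure (T - S N)"
  proof (rule ccontr)
    assume *: "\<nexists>N. \<not> T \<subseteq> closure (T - S N)"
    have "T \<subseteq> closure (\<Inter> (range (\<lambda>N. T - S N)))"
    proof (rule Baire)
      fix A assume "A \<in> range (\<lambda>N. T - S N)"
      then obtain N where A: "A = T - S N" by blast
      have "openin (top_of_set T) (T \<inter> - S N)" using S by (intro openin_open_Int) auto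
      then show "openin (top_of_set T) A \<and> T \<subseteq> closure A" using * by (auto simp: A Diff_eq)
    qed (auto simp: T_def)
    moreover have "\<Inter> (range (\<lambda>N. T - S N)) = {}"
      using TE cover unfolding E_def by blast
    ultimately show False using eT by (metis closure_empty empty_iff subsetD)
  qed
  then obtain N q where q: "q \<in> T" "q \<notin> closure (T - S N)" by blast
  then obtain s where s: "s > 0" "\<And>y. y \<in> T - S N \<Longrightarrow> s \<le> dist y q"
    unfolding closure_approachable by (metis linorder_not_less)
  obtain p where p: "p \<in> E \<inter> ball e r" "dist p q < s"
    using q(1) s(1) unfolding T_def closure_approachable by blast
  have "open (ball e r \<inter> ball q s)" by auto
  moreover have "p \<in> ball e r \<inter> ball q s" using p by (auto simp: dist_commute)
  ultimately obtain d where d: "d > 0" "ball p d \<subseteq> ball e r \<inter> ball q s"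
    by (meson openE)
  show ?thesis
  proof (rule that)
    show "p \<in> J - W" using p by (auto simp: E_def)
    show "ball p d \<subseteq> J" using d(2) r(2) ball_subset_cball by blast
    show "(J - W) \<inter> ball p d \<subseteq> S N"
    proof
      fix t assume t: "t \<in> (J - W) \<inter> ball p d"
      then have "t \<in> T" unfolding T_def using d by (intro closure_subset[THEN subsetD]) (auto simp: E_def)
      moreover have "dist t q < s" using t d by (auto simp: dist_commute)
      ultimately show "t \<in> S N" using s(2)[of t] by (cases "t \<in> S N") auto
    qed
  qed (rule d(1))
qed

lemma compact_gap:
  fixes E :: "real set"
  assumes E: "compact E" "c\<^sub>0 \<in> E" "c\<^sub>1 \<in> E" and t: "c\<^sub>0 \<le> t" "t \<le> c\<^sub>1" "t \<notin> E"
  obtains b c where "b \<in> E" "c \<in> E" "b < t" "t < c" "{b<..<c} \<inter> E = {}"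
proof -
  have lo: "compact (E \<inter> {c\<^sub>0..t})" "E \<inter> {c\<^sub>0..t} \<noteq> {}" and hi: "compact (E \<inter> {t..c\<^sub>1})" "E \<inter> {t..c\<^sub>1} \<noteq> {}"
    using E t by (auto intro!: compact_Int_closed)
  obtain b where b: "b \<in> E \<inter> {c\<^sub>0..t}" "\<And>x. x \<in> E \<inter> {c\<^sub>0..t} \<Longrightarrow> x \<le> b"
    using compact_attains_sup[OF lo] by blast
  obtain c where c: "c \<in> E \<inter> {t..c\<^sub>1}" "\<And>x. x \<in> E \<inter> {t..c\<^sub>1} \<Longrightarrow> c \<le> x"
    using compact_attains_inf[OF hi] by blast
  show ?thesis
  proof (rule that)
    show "b < t" "t < c" using b(1) c(1) t(3) by (auto simp: order_less_le)
    show "{b<..<c} \<inter> E = {}"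
    proof (rule ccontr)
      assume "{b<..<c} \<inter> E \<noteq> {}"
      then obtain x where x: "x \<in> E" "b < x" "x < c" by auto
      have "x \<le> b \<or> c \<le> x"
        using b(2)[of x] c(2)[of x] x b(1) c(1) by (cases "x \<le> t") auto
      then show False using x by simp
    qed
  qed (use b c in auto)
qed

lemma open_off_axis_or_Im_in:
  assumes "open T" shows "open {z. Re z \<noteq> 0 \<or> Im z \<in> T}"
proof -
  have "open ({z. Re z \<noteq> 0} \<union> Im -` T)"
    using assms by (intro open_Un open_Collect_neq open_vimage continuous_intros)
  moreover have "{z. Re z \<noteq> 0} \<union> Im -` T = {z. Re z \<noteq> 0 \<or> Im z \<in> T}" by auto
  ultimately show ?thesis by simp
qed

text \<open>The hypotheses are pointwise in \<open>t\<close>; the difficulty is to gain uniformity. Let \<open>W\<close> be the open set of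
  points near which \<open>g\<close> is holomorphic, and suppose that \<open>J - W\<close> is nonempty. Each radius carries a bound,
  so by Baire's theorem some portion of \<open>J - W\<close> carries a common bound \<open>N\<close>. In a gap of \<open>J - W\<close> the
  function is holomorphic across the axis, and both edges of the corresponding strip are good radii; the
  maximum principle with singular corners extends the bound to the strip. So \<open>g\<close> is bounded on a full
  neighbourhood of the portion, off the axis, and bounded singular segments are removable. The portion
  then lies in \<open>W\<close>, a contradiction.\<close>

theorem vholomorphic_across_axis:
  fixes g :: "complex \<Rightarrow> 'a::complex_banach"
  assumes hol: "g vholomorphic_on {z. Re z \<noteq> 0}"
    and growth: "\<And>z. \<bar>Re z\<bar> \<le> 1 \<Longrightarrow> \<bar>Re z\<bar> ^ n * norm (g z) \<le> M" and n: "0 < n"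
    and J: "open J"
    and radial: "\<And>t. t \<in> J \<Longrightarrow> ((\<lambda>e. g (Complex e t)) \<longlongrightarrow> g (Complex 0 t)) (at 0)"
  shows "g vholomorphic_on {z. Re z \<noteq> 0 \<or> Im z \<in> J}"
proof -
  have open_off: "open {z. Re z \<noteq> 0}" by (intro open_Collect_neq continuous_intros)
  have off: "vdiff_at g z" if "Re z \<noteq> 0" for z
    using hol that vholomorphic_on_open[OF open_off] by blast
  define W where "W = interior {t. vdiff_at g (Complex 0 t)}"
  have W: "vdiff_at g (Complex 0 t)" if "t \<in> W" for t
    using that interior_subset by (auto simp: W_def)
  define S where "S N = {t. \<forall>e. e \<noteq> 0 \<longrightarrow> \<bar>e\<bar> \<le> 1 \<longrightarrow> norm (g (Complex e t)) \<le> real N}" for N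
  have S: "closed (S N)" for N
  proof -
    have "closed {t. norm (g (Complex e t)) \<le> real N}" if "e \<noteq> 0" for e
    proof -
      have "continuous_on UNIV (\<lambda>t. g (Complex e t))"
      proof (intro continuous_at_imp_continuous_on ballI)
        fix t
        have "isCont g (Complex e t)" using off[of "Complex e t"] that by (simp add: vdiff_at_imp_continuous)
        moreover have "isCont (\<lambda>t. Complex e t) t" unfolding isCont_def by (intro tendsto_intros)
        ultimately show "isCont (\<lambda>t. g (Complex e t)) t" using isCont_o2 by blast
      qed
      then show ?thesis by (intro closed_Collect_le continuous_intros)
    qed
    moreover have "S N = (\<Inter>e\<in>{e. e \<noteq> 0 \<and> \<bar>e\<bar> \<le> 1}. {t. norm (g (Complex e t)) \<le> real N})"
      by (auto simp: S_def)
    ultimately show ?thesis by auto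
  qed
  have S_cover: "\<exists>N. t \<in> S N" if t: "t \<in> J" for t
  proof -
    have "continuous_on {-1..1} (\<lambda>e. g (Complex e t))"
    proof (intro continuous_at_imp_continuous_on ballI)
      fix e
      show "isCont (\<lambda>e. g (Complex e t)) e"
      proof (cases "e = 0")
        case True
        then show ?thesis using radial[OF t] by (simp add: isCont_def)
      next
        case False
        then have "isCont g (Complex e t)" using off[of "Complex e t"] by (simp add: vdiff_at_imp_continuous)
        moreover have "isCont (\<lambda>e. Complex e t) e" unfolding isCont_def by (intro tendsto_intros)
        ultimately show ?thesis using isCont_o2 by blast
      qed
    qed
    then have "bounded ((\<lambda>e. g (Complex e t)) ` {-1..1})"
      by (intro compact_imp_bounded compact_continuous_image) auto
    then obtain B where B: "\<And>e. e \<in> {-1..1} \<Longrightarrow> norm (g (Complex e t)) \<le> B"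
      unfolding bounded_iff by blast
    obtain N where N: "B \<le> real N" using real_arch_simple by blast
    have "norm (g (Complex e t)) \<le> real N" if "\<bar>e\<bar> \<le> 1" for e
      by (rule order_trans[OF B N]) (use that in auto)
    then show ?thesis by (auto simp: S_def)
  qed
  have "J \<subseteq> W"
  proof (rule ccontr)
    assume "\<not> J \<subseteq> W"
    then have "J - W \<noteq> {}" by blast
    moreover have "open W" by (simp add: W_def)
    moreover have "J - W \<subseteq> (\<Union>N. S N)" using S_cover by blast
    ultimately obtain p d N where p: "p \<in> J - W" and d: "d > 0" "ball p d \<subseteq> J"
      and EN: "(J - W) \<inter> ball p d \<subseteq> S N"
      using Baire_portion[OF J, of W S] S by metis
    (* The end points need not be singular, but any single radius over J is bounded; adding them to the
       singular points makes every remaining point of the interval lie in a gap with two good ends. *)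
    define c\<^sub>0 c\<^sub>1 where "c\<^sub>0 = p - d / 2" and "c\<^sub>1 = p + d / 2"
    have sub: "{c\<^sub>0..c\<^sub>1} \<subseteq> ball p d" using d by (auto simp: c\<^sub>0_def c\<^sub>1_def dist_real_def)
    have c01: "c\<^sub>0 \<in> J" "c\<^sub>1 \<in> J" "c\<^sub>0 < p" "p < c\<^sub>1"
      using sub d by (auto simp: c\<^sub>0_def c\<^sub>1_def subset_iff)
    obtain N\<^sub>0 N\<^sub>1 where N01: "c\<^sub>0 \<in> S N\<^sub>0" "c\<^sub>1 \<in> S N\<^sub>1" using S_cover c01 by blast
    define K where "K = Max {real N, real N\<^sub>0, real N\<^sub>1, M}"
    have K: "real N \<le> K" "real N\<^sub>0 \<le> K" "real N\<^sub>1 \<le> K" "M \<le> K" by (auto simp: K_def)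
    define E where "E = ({c\<^sub>0..c\<^sub>1} - W) \<union> {c\<^sub>0, c\<^sub>1}"
    have "compact ({c\<^sub>0..c\<^sub>1} \<inter> - W)" by (intro compact_Int_closed) (auto simp: W_def)
    then have cE: "compact E" unfolding E_def Diff_eq by (intro compact_Un) auto
    have SK: "norm (g (Complex e t)) \<le> K" if "t \<in> S N'" "real N' \<le> K" "e \<noteq> 0" "\<bar>e\<bar> \<le> 1" for e t N'
      using that order_trans by (auto simp: S_def)
    have EK: "norm (g (Complex e t)) \<le> K" if t: "t \<in> E" and e: "e \<noteq> 0" "\<bar>e\<bar> \<le> 1" for e t
    proof -
      have "t \<in> S N \<or> t \<in> S N\<^sub>0 \<or> t \<in> S N\<^sub>1"
        using t N01 EN sub d(2) unfolding E_def by blast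
      then show ?thesis using SK[OF _ _ e] K by blast
    qed
    have strip: "norm (g (Complex e t)) \<le> K"
      if t: "c\<^sub>0 \<le> t" "t \<le> c\<^sub>1" and e: "e \<noteq> 0" "\<bar>e\<bar> < 1" for e t
    proof (cases "t \<in> E")
      case True
      then show ?thesis using EK e by simp
    next
      case False
      have cE0: "c\<^sub>0 \<in> E" "c\<^sub>1 \<in> E" by (auto simp: E_def)
      obtain b c where bc: "b \<in> E" "c \<in> E" "b < t" "t < c" "{b<..<c} \<inter> E = {}"
        using compact_gap[OF cE cE0 t False] .
      have "c\<^sub>0 \<le> b" "c \<le> c\<^sub>1" using bc c01 by (auto simp: E_def)
      then have bcW: "{b<..<c} \<subseteq> W" using bc(5) by (auto simp: E_def)
      show ?thesis
      proof (rule norm_le_if_functionals_le)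
        fix \<phi> :: "'a \<Rightarrow> complex" assume \<phi>: "contractive_functional \<phi>"
        note le = order_trans[OF contractive_functional_le[OF \<phi>]]
        show "cmod (\<phi> (g (Complex e t))) \<le> K"
        proof (rule strip_bound[where G = "\<lambda>z. \<phi> (g z)" and b = b and c = c and n = n and M = M])
          have "g vholomorphic_on {z. Re z \<noteq> 0 \<or> Im z \<in> {b<..<c}}"
            unfolding vholomorphic_on_open[OF open_off_axis_or_Im_in[OF open_greaterThanLessThan]]
          proof
            fix z assume z: "z \<in> {z. Re z \<noteq> 0 \<or> Im z \<in> {b<..<c}}"
            show "vdiff_at g z"
            proof (cases "Re z = 0")
              case True
              then have "z = Complex 0 (Im z)" by (simp add: complex_eq_iff)
              moreover have "Im z \<in> W" using z True bcW by auto
              ultimately show ?thesis using W by metis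
            qed (rule off)
          qed
          from vholomorphic_imp_functional_holomorphic[OF this \<phi>]
          show "(\<lambda>z. \<phi> (g z)) holomorphic_on {z. Re z \<noteq> 0 \<or> b < Im z \<and> Im z < c}" by simp
          show "\<bar>Re z\<bar> ^ n * cmod (\<phi> (g z)) \<le> M" if "\<bar>Re z\<bar> \<le> 1" for z
            by (rule order_trans[OF _ growth[OF that]])
              (intro mult_left_mono contractive_functional_le[OF \<phi>], simp)
          show "cmod (\<phi> (g (Complex x s))) \<le> K" if "x \<noteq> 0" "\<bar>x\<bar> \<le> 1" "s = b \<or> s = c" for x s
            by (rule le[OF EK]) (use that bc in auto)
        qed (use n K e bc in auto)
      qed
    qed
    define V where "V = {z. \<bar>Re z\<bar> < 1 \<and> c\<^sub>0 < Im z \<and> Im z < c\<^sub>1}"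
    have V: "V = box (Complex (-1) c\<^sub>0) (Complex 1 c\<^sub>1)" by (auto simp: V_def in_box_complex_iff)
    have oV: "open V" by (simp add: V open_box)
    have rad: "((\<lambda>e. g (Complex e t)) \<longlongrightarrow> g (Complex 0 t)) (at 0)" if "c\<^sub>0 < t" "t < c\<^sub>1" for t
    proof -
      have "t \<in> {c\<^sub>0..c\<^sub>1}" using that by simp
      then have "t \<in> J" using sub d(2) by blast
      then show ?thesis by (rule radial)
    qed
    have onK: "norm (g (Complex 0 t)) \<le> K" if t: "c\<^sub>0 < t" "t < c\<^sub>1" for t
    proof (rule tendsto_upperbound[OF tendsto_norm[OF rad[OF t]]])
      show "\<forall>\<^sub>F e in at 0. norm (g (Complex e t)) \<le> K"
        unfolding eventually_at using strip t by (intro exI[of _ 1]) (auto simp: dist_real_def)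
    qed simp
    have VK: "norm (g z) \<le> K" if "z \<in> V" for z
      using strip[of "Im z" "Re z"] onK[of "Im z"] that
      by (cases "Re z = 0") (auto simp: V_def, metis complex_surj)
    have "g vholomorphic_on V"
    proof (rule weakly_holomorphic_imp_vholomorphic[OF oV])
      fix z assume "z \<in> V"
      then obtain r where "r > 0" "ball z r \<subseteq> V" using oV openE by blast
      then show "\<exists>r>0. \<exists>B. \<forall>w\<in>ball z r. norm (g w) \<le> B" using VK by blast
    next
      fix \<phi> :: "'a \<Rightarrow> complex" assume \<phi>: "contractive_functional \<phi>"
      show "(\<lambda>z. \<phi> (g z)) holomorphic_on V"
        unfolding V_def
      proof (rule holomorphic_across_axis)
        show "(\<lambda>z. \<phi> (g z)) holomorphic_on {z. Re z \<noteq> 0}"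
          by (rule vholomorphic_imp_functional_holomorphic[OF hol \<phi>])
        show "cmod (\<phi> (g (Complex e t))) \<le> K" if "0 < \<bar>e\<bar>" "\<bar>e\<bar> < 1" "c\<^sub>0 < t" "t < c\<^sub>1" for e t
          by (rule order_trans[OF contractive_functional_le[OF \<phi>] strip]) (use that in auto)
        show "((\<lambda>e. \<phi> (g (Complex e t))) \<longlongrightarrow> \<phi> (g (Complex 0 t))) (at 0)" if "c\<^sub>0 < t" "t < c\<^sub>1" for t
          by (rule bounded_linear.tendsto[OF contractive_functional_bounded_linear[OF \<phi>] rad[OF that]])
      qed
    qed
    then have "vdiff_at g (Complex 0 t)" if "t \<in> {c\<^sub>0<..<c\<^sub>1}" for t
      using that vholomorphic_on_open[OF oV, of g] by (simp add: V_def)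
    then have "{c\<^sub>0<..<c\<^sub>1} \<subseteq> W" unfolding W_def by (intro interior_maximal) auto
    then show False using p c01 by auto
  qed
  then show ?thesis
    unfolding vholomorphic_on_open[OF open_off_axis_or_Im_in[OF J]]
  proof (intro ballI)
    fix z assume JW: "J \<subseteq> W" and z: "z \<in> {z. Re z \<noteq> 0 \<or> Im z \<in> J}"
    show "vdiff_at g z"
    proof (cases "Re z = 0")
      case True
      then have "z = Complex 0 (Im z)" by (simp add: complex_eq_iff)
      moreover have "Im z \<in> W" using z True JW by auto
      ultimately show ?thesis using W by metis
    qed (rule off)
  qed
qed

section \<open>Groups of polynomial growth and their resolvents\<close>

lemma antiderivative_exists:
  fixes f :: "real \<Rightarrow> 'a::banach"
  assumes "continuous_on UNIV f"
  obtains V where "\<And>t. (V has_vector_derivative f t) (at t)"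
proof -
  define V where "V u = integral {0..u} f - integral {u..0} f" for u
  have int: "f integrable_on {a..b}" for a b
    by (intro integrable_continuous_real continuous_on_subset[OF assms]) auto
  have "(V has_vector_derivative f t) (at t)" for t
  proof -
    define c where "c = \<bar>t\<bar> + 1"
    have c: "c > 0" "t \<in> {-c<..<c}" by (auto simp: c_def)
    have V: "V u = integral {-c..u} f - integral {-c..0} f" if u: "u \<in> {-c<..<c}" for u
    proof (cases "0 \<le> u")
      case True
      have "integral {-c..0} f + integral {0..u} f = integral {-c..u} f"
        by (rule Henstock_Kurzweil_Integration.integral_combine) (use True c int in auto)
      then show ?thesis using True by (cases "u = 0") (simp_all add: V_def eq_diff_eq add.commute)
    next
      case False
      have "integral {-c..0} f = integral {-c..u} f + integral {u..0} f"
        by (rule Henstock_Kurzweil_Integration.integral_combine[symmetric])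
          (use False u int in auto)
      then show ?thesis using False by (simp add: V_def)
    qed
    have "((\<lambda>u. integral {-c..u} f) has_vector_derivative f t) (at t within {-c..c})"
      using c by (intro integral_has_vector_derivative continuous_on_subset[OF assms]) auto
    then have "((\<lambda>u. integral {-c..u} f) has_vector_derivative f t) (at t within {-c<..<c})"
      by (rule has_vector_derivative_within_subset) auto
    then have "((\<lambda>u. integral {-c..u} f) has_vector_derivative f t) (at t)"
      using at_within_open[OF c(2)] by simp
    then have "((\<lambda>u. integral {-c..u} f - integral {-c..0} f) has_vector_derivative f t - 0) (at t)"
      by (intro has_vector_derivative_diff has_vector_derivative_const)
    then have "((\<lambda>u. integral {-c..u} f - integral {-c..0} f) has_vector_derivative f t) (at t)" by simp
    then show ?thesis
      by (rule has_vector_derivative_transform_within_open[where S = "{-c<..<c}"]) (use V c in auto)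
  qed
  then show ?thesis by (rule that)
qed

lemma has_vector_derivative_zero_imp_eq:
  fixes f :: "real \<Rightarrow> 'a::real_normed_vector"
  assumes "\<And>t. (f has_vector_derivative 0) (at t)"
  shows "f s = f t"
proof -
  obtain c where "\<And>t. t \<in> UNIV \<Longrightarrow> f t = c"
    using has_vector_derivative_zero_constant[of UNIV f] assms by auto
  then show ?thesis by simp
qed

lemma shift_iff: "(x, w) \<in> shift \<mu> A \<longleftrightarrow> (x, \<mu> *\<^sub>C x - w) \<in> A"
proof
  assume "(x, \<mu> *\<^sub>C x - w) \<in> A"
  moreover have "w = \<mu> *\<^sub>C x - (\<mu> *\<^sub>C x - w)" by simp
  ultimately show "(x, w) \<in> shift \<mu> A" unfolding shift_def by blast
qed (auto simp: shift_def)

text \<open>The growth bound in the form in which it enters Laplace transforms: \<open>1 + |t|^a\<close> is dominated, with the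
  optimal power of \<open>\<epsilon>\<close>, by \<open>\<epsilon>^(-a) exp (\<epsilon> |t| / 2)\<close>, for every \<open>\<epsilon>\<close> in \<open>(0, 1]\<close>. The factor 1/2 leaves
  room for convergence against \<open>exp (-\<epsilon> t)\<close>.\<close>

locale tempered_group =
  fixes T :: "real \<Rightarrow> 'a::complex_banach \<Rightarrow> 'a" and M a :: real
  assumes C0: "C0_group T"
    and growth: "\<And>\<epsilon> t x. 0 < \<epsilon> \<Longrightarrow> \<epsilon> \<le> 1 \<Longrightarrow>
      norm (T t x) \<le> M * \<epsilon> powr (- a) * exp (\<epsilon> * \<bar>t\<bar> / 2) * norm x"
    and M: "0 \<le> M" and a: "0 \<le> a"
begin

abbreviation A :: "('a \<times> 'a) set" where "A \<equiv> generator T"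

lemma T_bounded_linear: "bounded_linear (T t)" and T_scaleC: "T t (c *\<^sub>C x) = c *\<^sub>C T t x"
  and T_0 [simp]: "T 0 x = x" and T_plus: "T (s + t) x = T s (T t x)"
  and T_continuous: "continuous_on UNIV (\<lambda>t. T t x)"
  using C0 by (auto simp: C0_group_def bounded_clinear_def)

lemma T_add: "T t (x + y) = T t x + T t y" and T_diff: "T t (x - y) = T t x - T t y"
  using T_bounded_linear[of t] by (simp_all add: linear_simps)

lemma generator_iff: "(x, y) \<in> A \<longleftrightarrow> ((\<lambda>t. T t x) has_vector_derivative y) (at 0)"
proof -
  have "norm ((T h x - x) /\<^sub>R h - y) = norm (T h x - x - h *\<^sub>R y) / norm h" if "h \<noteq> 0" for h
  proof -
    have "(T h x - x) /\<^sub>R h - y = (T h x - x - h *\<^sub>R y) /\<^sub>R h"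
      using that by (simp add: scaleR_diff_right)
    then show ?thesis by (simp add: divide_inverse mult.commute)
  qed
  then have "((\<lambda>h. norm ((T h x - x) /\<^sub>R h - y)) \<longlongrightarrow> 0) (at 0) \<longleftrightarrow>
      ((\<lambda>h. norm (T h x - x - h *\<^sub>R y) / norm h) \<longlongrightarrow> 0) (at 0)"
    by (intro LIM_equal) simp
  then show ?thesis
    unfolding generator_def has_vector_derivative_def has_derivative_at mem_Collect_eq case_prod_conv
    by (simp add: LIM_zero_iff tendsto_norm_zero_iff bounded_linear_scaleR_left)
qed

lemma generator_add: "(x, y) \<in> A \<Longrightarrow> (x', y') \<in> A \<Longrightarrow> (x + x', y + y') \<in> A"
  unfolding generator_iff T_add by (rule has_vector_derivative_add)

lemma generator_scaleC: "(x, y) \<in> A \<Longrightarrow> (c *\<^sub>C x, c *\<^sub>C y) \<in> A"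
  unfolding generator_iff T_scaleC
  by (rule bounded_linear.has_vector_derivative[OF
        bounded_bilinear.bounded_linear_right[OF bounded_bilinear_scaleC]])

lemma generator_orbit:
  assumes "(x, y) \<in> A" shows "((\<lambda>t. T t x) has_vector_derivative T t y) (at t)"
proof -
  have "((\<lambda>s. s - t) has_vector_derivative 1) (at t)"
    by (auto intro!: derivative_eq_intros)
  from vector_diff_chain_at[OF this, of "\<lambda>s. T s x" y] assms
  have "((\<lambda>s. T (s - t) x) has_vector_derivative y) (at t)"
    by (simp add: generator_iff o_def)
  then have "((\<lambda>s. T t (T (s - t) x)) has_vector_derivative T t y) (at t)"
    by (rule bounded_linear.has_vector_derivative[OF T_bounded_linear])
  moreover have "T t (T (s - t) x) = T s x" for s
    using T_plus[of t "s - t" x] by simp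
  ultimately show ?thesis by simp
qed

text \<open>On \<open>[-|h|, |h|]\<close> the function \<open>s \<mapsto> T s (x n) - s (y n)\<close> has the small derivative
  \<open>T s (y n) - y n\<close>. The resulting mean value estimate survives the limit in \<open>n\<close>, because \<open>T s\<close> is uniformly
  bounded for \<open>|s| \<le> 1\<close>.\<close>

lemma generator_closed:
  assumes A: "\<And>n. (x n, y n) \<in> A" and x: "x \<longlonglongrightarrow> x'" and y: "y \<longlonglongrightarrow> y'"
  shows "(x', y') \<in> A"
proof -
  define K where "K = M * exp (1/2)"
  have K: "norm (T s v) \<le> K * norm v" if "\<bar>s\<bar> \<le> 1" for s v
  proof -
    have "norm (T s v) \<le> M * exp (\<bar>s\<bar> / 2) * norm v" using growth[of 1 s v] by simp
    also have "\<dots> \<le> K * norm v"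
      unfolding K_def using that M by (intro mult_right_mono mult_left_mono) auto
    finally show ?thesis .
  qed
  have "\<exists>d>0. \<forall>h. norm (h - 0) < d \<longrightarrow> norm (T h x' - T 0 x' - (h - 0) *\<^sub>R y') \<le> e * norm (h - 0)"
    if e: "e > 0" for e
  proof -
    have "isCont (\<lambda>t. T t y') 0" using T_continuous continuous_on_eq_continuous_at by blast
    then obtain d where d: "d > 0" "\<And>s. \<bar>s\<bar> < d \<Longrightarrow> norm (T s y' - y') < e"
      unfolding continuous_at_eps_delta using e by (auto simp: dist_norm)
    have "norm (T h x' - x' - h *\<^sub>R y') \<le> e * \<bar>h\<bar>" if h: "\<bar>h\<bar> < min d 1" for h
    proof -
      define b where "b n = e + (K + 1) * norm (y n - y')" for n
      have "norm (T h (x n) - x n - h *\<^sub>R y n) \<le> b n * \<bar>h\<bar>" for n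
      proof -
        have "norm ((T h (x n) - h *\<^sub>R y n) - (T 0 (x n) - 0 *\<^sub>R y n)) \<le> b n * norm (h - 0)"
        proof (rule differentiable_bound[of "closed_segment 0 h" "\<lambda>s. T s (x n) - s *\<^sub>R y n"
              "\<lambda>s k. k *\<^sub>R (T s (y n) - y n)"])
          fix s assume "s \<in> closed_segment 0 h"
          then have s: "\<bar>s\<bar> \<le> \<bar>h\<bar>" by (auto simp: closed_segment_eq_real_ivl split: if_splits)
          have "((\<lambda>s. T s (x n) - s *\<^sub>R y n) has_vector_derivative T s (y n) - 1 *\<^sub>R y n) (at s)"
            by (intro has_vector_derivative_diff generator_orbit A)
              (auto intro!: derivative_eq_intros simp: has_vector_derivative_def)
          then show "((\<lambda>s. T s (x n) - s *\<^sub>R y n) has_derivative (\<lambda>k. k *\<^sub>R (T s (y n) - y n)))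
              (at s within closed_segment 0 h)"
            by (simp add: has_vector_derivative_def has_derivative_at_withinI)
          have "T s (y n) - y n = (T s y' - y') + (T s (y n - y') - (y n - y'))" by (simp add: T_diff)
          then have "norm (T s (y n) - y n) \<le>
              norm (T s y' - y') + (norm (T s (y n - y')) + norm (y n - y'))"
            by (metis norm_triangle_le norm_triangle_ineq4 add_left_mono)
          also have "\<dots> \<le> b n"
            using d(2)[of s] K[of s "y n - y'"] s h by (simp add: b_def algebra_simps)
          finally show "onorm (\<lambda>k. k *\<^sub>R (T s (y n) - y n)) \<le> b n"
            by (intro onorm_le) (simp add: mult.commute[of "b n"] mult_left_mono)
        qed auto
        then show ?thesis by (simp add: algebra_simps)
      qed
      moreover have "(\<lambda>n. norm (T h (x n) - x n - h *\<^sub>R y n)) \<longlonglongrightarrow> norm (T h x' - x' - h *\<^sub>R y')"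
        by (intro tendsto_intros x y bounded_linear.tendsto[OF T_bounded_linear])
      moreover have "(\<lambda>n. b n * \<bar>h\<bar>) \<longlonglongrightarrow> (e + (K + 1) * norm (y' - y')) * \<bar>h\<bar>"
        unfolding b_def by (intro tendsto_intros y)
      ultimately show ?thesis using LIMSEQ_le by fastforce
    qed
    then show ?thesis using d(1) by (intro exI[of _ "min d 1"]) auto
  qed
  then show ?thesis
    unfolding generator_iff has_vector_derivative_def has_derivative_at_alt
    by (simp add: bounded_linear_scaleR_left)
qed

text \<open>The choice \<open>\<epsilon> = min 1 (Re \<mu>)\<close> is what turns the growth bound into exponential decay of the integrand of the
  Laplace transform.\<close>

lemma decay:
  assumes "0 < Re \<mu>" "0 \<le> t"
  defines "\<epsilon> \<equiv> min 1 (Re \<mu>)"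
  shows "norm (exp (- \<mu> * of_real t) *\<^sub>C T t x) \<le> M * \<epsilon> powr (- a) * norm x * exp (- (\<epsilon> / 2) * t)"
proof -
  have \<epsilon>: "0 < \<epsilon>" "\<epsilon> \<le> 1" "\<epsilon> \<le> Re \<mu>" using assms by auto
  have "norm (exp (- \<mu> * of_real t) *\<^sub>C T t x) = exp (- Re \<mu> * t) * norm (T t x)"
    by (simp add: norm_scaleC)
  also have "\<dots> \<le> exp (- \<epsilon> * t) * (M * \<epsilon> powr (- a) * exp (\<epsilon> * t / 2) * norm x)"
    using growth[OF \<epsilon>(1,2), of t x] \<epsilon> assms(2) by (intro mult_mono) (auto intro: mult_right_mono)
  also have "\<dots> = M * \<epsilon> powr (- a) * norm x * (exp (- \<epsilon> * t) * exp (\<epsilon> * t / 2))" by simp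
  also have "exp (- \<epsilon> * t) * exp (\<epsilon> * t / 2) = exp (- (\<epsilon> / 2) * t)"
    by (simp flip: exp_add add: field_simps)
  finally show ?thesis .
qed

lemma exp_vector_derivative:
  "((\<lambda>t. exp (\<mu> * complex_of_real t)) has_vector_derivative \<mu> * exp (\<mu> * of_real t)) (at t)"
proof -
  have "((\<lambda>z. exp (\<mu> * z)) has_field_derivative \<mu> * exp (\<mu> * of_real t)) (at (of_real t))"
    by (auto intro!: derivative_eq_intros)
  then show ?thesis by (rule has_vector_derivative_real_field)
qed

lemma exp_decay_seq: "0 < \<delta> \<Longrightarrow> (\<lambda>n. exp (- \<delta> * real n)) \<longlonglongrightarrow> 0"
proof -
  assume "0 < \<delta>"
  then have "(\<lambda>n. exp (- \<delta>) ^ n) \<longlonglongrightarrow> 0" by (intro LIMSEQ_power_zero) simp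
  then show ?thesis by (simp add: exp_of_nat_mult mult.commute flip: exp_of_nat2_mult)
qed

text \<open>The orbit of an eigenvector is \<open>exp (\<mu> t) z\<close>, which grows too fast unless \<open>z = 0\<close>.\<close>

lemma eigenvector_zero:
  assumes \<mu>: "0 < Re \<mu>" and z: "(z, \<mu> *\<^sub>C z) \<in> A" shows "z = 0"
proof -
  let ?u = "\<lambda>t. exp (- \<mu> * of_real t) *\<^sub>C T t z"
  have "(?u has_vector_derivative exp (- \<mu> * of_real t) *\<^sub>C T t (\<mu> *\<^sub>C z)
      + (- \<mu> * exp (- \<mu> * of_real t)) *\<^sub>C T t z) (at t)" for t
    by (rule bounded_bilinear.has_vector_derivative[OF bounded_bilinear_scaleC
          exp_vector_derivative generator_orbit[OF z]])
  then have "(?u has_vector_derivative 0) (at t)" for t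
    by (simp add: T_scaleC scaleC_scaleC mult.commute)
  then have u: "?u t = z" for t using has_vector_derivative_zero_imp_eq[of ?u t 0] by simp
  define \<epsilon> where "\<epsilon> = min 1 (Re \<mu>)"
  have "(\<lambda>n. M * \<epsilon> powr (- a) * norm z * exp (- (\<epsilon> / 2) * real n)) \<longlonglongrightarrow> M * \<epsilon> powr (- a) * norm z * 0"
    using \<mu> by (intro tendsto_mult tendsto_const exp_decay_seq) (auto simp: \<epsilon>_def)
  then have "norm z \<le> M * \<epsilon> powr (- a) * norm z * 0"
  proof (rule LIMSEQ_le_const)
    show "\<exists>N. \<forall>n\<ge>N. norm z \<le> M * \<epsilon> powr (- a) * norm z * exp (- (\<epsilon> / 2) * real n)"
      using decay[OF \<mu> of_nat_0_le_iff, of _ z] unfolding u \<epsilon>_def by blast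
  qed
  then show ?thesis by simp
qed

text \<open>The solution is the Laplace transform of the orbit. It is obtained as the limit of the truncated
  integrals \<open>V n - V 0\<close>, where \<open>V\<close> is an antiderivative of \<open>S t = exp (-\<mu> t) T t x\<close>: these solve the equation
  up to the error \<open>S n\<close>, which tends to 0, and the generator is closed.\<close>

lemma resolvent_equation_solvable:
  assumes \<mu>: "0 < Re \<mu>"
  shows "\<exists>z. (z, \<mu> *\<^sub>C z - x) \<in> A \<and> norm z \<le> 2 * M * min 1 (Re \<mu>) powr (- a - 1) * norm x"
proof -
  define \<epsilon> where "\<epsilon> = min 1 (Re \<mu>)"
  have \<epsilon>: "0 < \<epsilon>" using \<mu> by (simp add: \<epsilon>_def)
  define c where "c = 2 * M * \<epsilon> powr (- a - 1) * norm x"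
  have c: "c * (\<epsilon> / 2) = M * \<epsilon> powr (- a) * norm x"
    using \<epsilon> powr_add[of \<epsilon> "- a - 1" 1] by (simp add: c_def)
  have c0: "0 \<le> c" using M by (simp add: c_def)
  define S where "S t = exp (- \<mu> * of_real t) *\<^sub>C T t x" for t
  have "continuous_on UNIV S"
    unfolding S_def
    by (intro bounded_bilinear.continuous_on[OF bounded_bilinear_scaleC] T_continuous continuous_intros)
  then obtain V where V: "\<And>t. (V has_vector_derivative S t) (at t)"
    using antiderivative_exists by blast
  have Vc: "(V \<circ> (\<lambda>u. u + h) has_vector_derivative S (t + h)) (at t)" for t h
    using vector_diff_chain_at[of "\<lambda>u. u + h" 1 t V "S (t + h)"] V
    by (auto intro!: derivative_eq_intros simp: has_vector_derivative_def)
  define z where "z n = V (real n) - V 0" for n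
  (* The group shifts the integral: both sides vanish at u = 0 and have the same derivative in u. *)
  have Tz: "T h (V u - V 0) = exp (\<mu> * of_real h) *\<^sub>C (V (u + h) - V h)" for h u
  proof -
    let ?D = "\<lambda>u. T h (V u - V 0) - exp (\<mu> * of_real h) *\<^sub>C (V (u + h) - V h)"
    have "(?D has_vector_derivative T h (S t - 0) - exp (\<mu> * of_real h) *\<^sub>C (S (t + h) - 0)) (at t)" for t
      by (intro has_vector_derivative_diff has_vector_derivative_const V
          bounded_linear.has_vector_derivative[OF T_bounded_linear] Vc[unfolded o_def]
          bounded_linear.has_vector_derivative[OF
            bounded_bilinear.bounded_linear_right[OF bounded_bilinear_scaleC]])
    moreover have "T h (S t) = exp (\<mu> * of_real h) *\<^sub>C S (t + h)" for t
      by (simp add: S_def T_scaleC scaleC_scaleC flip: T_plus exp_add) (simp add: algebra_simps)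
    ultimately have "(?D has_vector_derivative 0) (at t)" for t by simp
    then have "?D u = ?D 0" by (rule has_vector_derivative_zero_imp_eq)
    then show ?thesis using linear_0[OF bounded_linear.linear[OF T_bounded_linear]] by simp
  qed
  have zA: "(z n, \<mu> *\<^sub>C z n - x + S n) \<in> A" for n
  proof -
    have "((\<lambda>h. V (real n + h)) has_vector_derivative S (real n + 0)) (at 0)"
      using Vc[where t = 0 and h = "real n"] by (simp only: o_def add.commute[of _ "real n"])
    then have "((\<lambda>h. exp (\<mu> * of_real h) *\<^sub>C (V (real n + h) - V h)) has_vector_derivative
        exp (\<mu> * of_real 0) *\<^sub>C (S (real n + 0) - S 0) +
        (\<mu> * exp (\<mu> * of_real 0)) *\<^sub>C (V (real n + 0) - V 0)) (at 0)"
      by (intro bounded_bilinear.has_vector_derivative[OF bounded_bilinear_scaleC]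
          exp_vector_derivative has_vector_derivative_diff V)
    then show ?thesis
      unfolding generator_iff z_def Tz by (simp add: S_def algebra_simps)
  qed
  have Vle: "norm (V t - V s) \<le> c * exp (- (\<epsilon> / 2) * s)" if st: "0 \<le> s" "s < t" for s t
  proof -
    have "norm (V t - V s) \<le> - c * exp (- (\<epsilon> / 2) * t) - - c * exp (- (\<epsilon> / 2) * s)"
    proof (rule differentiable_bound_general[OF st(2)])
      show "continuous_on {s..t} V"
        using V has_vector_derivative_continuous continuous_at_imp_continuous_on by blast
      show "((\<lambda>t. - c * exp (- (\<epsilon> / 2) * t)) has_vector_derivative
          M * \<epsilon> powr (- a) * norm x * exp (- (\<epsilon> / 2) * u)) (at u)" for u
        unfolding c[symmetric] has_real_derivative_iff_has_vector_derivative[symmetric]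
        by (auto intro!: derivative_eq_intros)
      show "norm (S u) \<le> M * \<epsilon> powr (- a) * norm x * exp (- (\<epsilon> / 2) * u)" if "s < u" for u
        unfolding S_def \<epsilon>_def using decay[OF \<mu>, of u x] st that by simp
          show "continuous_on {s..t} (\<lambda>u. - c * exp (- (\<epsilon> / 2) * u))" by (intro continuous_intros)
    qed (rule V)
    also have "\<dots> \<le> c * exp (- (\<epsilon> / 2) * s)" using c0 by simp
    finally show ?thesis .
  qed
  have ctend: "(\<lambda>n. c * exp (- (\<epsilon> / 2) * real n)) \<longlonglongrightarrow> 0"
    using tendsto_mult[OF tendsto_const exp_decay_seq[of "\<epsilon> / 2"], of c] \<epsilon> by simp
  have "Cauchy z"
  proof (rule CauchyI')
    fix e :: real assume "0 < e"
    then obtain n0 where n0: "\<And>n. n \<ge> n0 \<Longrightarrow> c * exp (- (\<epsilon> / 2) * real n) < e"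
      using order_tendstoD(2)[OF ctend] by (auto simp: eventually_sequentially)
    have "dist (z m) (z n) < e" if "m \<ge> n0" "n > m" for m n
      using Vle[of "real m" "real n"] n0[OF that(1)] that by (simp add: z_def dist_norm norm_minus_commute)
    then show "\<exists>N. \<forall>m\<ge>N. \<forall>n>m. dist (z m) (z n) < e" by blast
  qed
  then obtain z' where z': "z \<longlonglongrightarrow> z'" using Cauchy_convergent convergent_def by blast
  have "(\<lambda>n. S (real n)) \<longlonglongrightarrow> 0"
  proof (rule Lim_null_comparison)
    show "\<forall>\<^sub>F n in sequentially. norm (S (real n)) \<le> M * \<epsilon> powr (- a) * norm x * exp (- (\<epsilon> / 2) * real n)"
      unfolding S_def \<epsilon>_def using decay[OF \<mu> of_nat_0_le_iff] by simp
    show "(\<lambda>n. M * \<epsilon> powr (- a) * norm x * exp (- (\<epsilon> / 2) * real n)) \<longlonglongrightarrow> 0"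
      using tendsto_mult[OF tendsto_const exp_decay_seq[of "\<epsilon> / 2"]] \<epsilon> by fastforce
  qed
  then have "(\<lambda>n. \<mu> *\<^sub>C z n - x + S n) \<longlonglongrightarrow> \<mu> *\<^sub>C z' - x + 0"
    by (intro tendsto_intros bounded_bilinear.tendsto[OF bounded_bilinear_scaleC] z')
  then have "(z', \<mu> *\<^sub>C z' - x) \<in> A" using generator_closed[OF zA z'] by simp
  moreover have "norm z' \<le> c"
  proof (rule LIMSEQ_le_const2[OF tendsto_norm[OF z']])
    show "\<exists>N. \<forall>n\<ge>N. norm (z n) \<le> c"
      using Vle[of 0 "real n" for n] by (intro exI[of _ 1]) (auto simp: z_def)
  qed
  ultimately show ?thesis unfolding c_def \<epsilon>_def by blast
qed

end

section \<open>Local resolvents and ranges of powers\<close>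

lemma vholomorphic_on_minus:
  assumes "h vholomorphic_on U" shows "(\<lambda>z. - h z) vholomorphic_on U"
  unfolding vholomorphic_on_def
proof
  fix z assume "z \<in> U"
  then obtain D where "(h has_derivative (\<lambda>k. k *\<^sub>C D)) (at z within U)"
    using assms by (auto simp: vholomorphic_on_def)
  from has_derivative_minus[OF this]
  have "((\<lambda>z. - h z) has_derivative (\<lambda>k. k *\<^sub>C (- D))) (at z within U)" by simp
  then show "\<exists>D. ((\<lambda>z. - h z) has_derivative (\<lambda>k. k *\<^sub>C D)) (at z within U)" by blast
qed

context tempered_group
begin

text \<open>Reversing time exchanges the two half-planes, so results for \<open>Re \<mu> > 0\<close> carry over to \<open>Re \<mu> < 0\<close>.\<close>

lemma reflected: "tempered_group (\<lambda>t. T (- t)) M a"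
proof
  have "T (- (s + t)) x = T (- s) (T (- t) x)" for s t x
    using T_plus[of "- s" "- t" x] by simp
  moreover have "continuous_on UNIV (\<lambda>t. T (- t) x)" for x
    using continuous_on_compose2[OF T_continuous[of x], of UNIV uminus]
    by (simp add: continuous_on_minus)
  ultimately show "C0_group (\<lambda>t. T (- t))"
    unfolding C0_group_def using T_bounded_linear T_scaleC by (simp add: bounded_clinear_def)
  show "norm (T (- t) x) \<le> M * \<epsilon> powr (- a) * exp (\<epsilon> * \<bar>t\<bar> / 2) * norm x"
    if "0 < \<epsilon>" "\<epsilon> \<le> 1" for \<epsilon> t x
    using growth[OF that, of "- t" x] by simp
qed (use M a in auto)

lemma generator_reflected: "(x, y) \<in> generator (\<lambda>t. T (- t)) \<longleftrightarrow> (x, - y) \<in> A"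
proof -
  have flip: "((\<lambda>t. f (- t)) has_vector_derivative - v) (at 0)"
    if "(f has_vector_derivative v) (at 0)" for f :: "real \<Rightarrow> 'a" and v
  proof -
    have "((\<lambda>t::real. - t) has_vector_derivative - 1) (at 0)"
      by (rule has_vector_derivative_minus[OF has_vector_derivative_id])
    from vector_diff_chain_at[OF this, of f v] that show ?thesis by (simp add: o_def)
  qed
  have "((\<lambda>t. T (- t) x) has_vector_derivative y) (at 0) \<longleftrightarrow>
      ((\<lambda>t. T t x) has_vector_derivative - y) (at 0)"
    using flip[of "\<lambda>t. T (- t) x" y] flip[of "\<lambda>t. T t x" "- y"] by auto
  then show ?thesis
    unfolding generator_iff tempered_group.generator_iff[OF reflected] .
qed

lemma resolvent_equation_off_axis:
  assumes "Re \<mu> \<noteq> 0"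
  shows "\<exists>z. (z, \<mu> *\<^sub>C z - x) \<in> A \<and> norm z \<le> 2 * M * min 1 \<bar>Re \<mu>\<bar> powr (- a - 1) * norm x"
proof (cases "Re \<mu> > 0")
  case True
  then show ?thesis using resolvent_equation_solvable[of \<mu> x] by simp
next
  case False
  then have "0 < Re (- \<mu>)" using assms by simp
  from tempered_group.resolvent_equation_solvable[OF reflected this, of "- x"]
  obtain z where "(z, - (- \<mu> *\<^sub>C z - - x)) \<in> A"
    "norm z \<le> 2 * M * min 1 (Re (- \<mu>)) powr (- a - 1) * norm (- x)"
    unfolding generator_reflected by blast
  then show ?thesis using False by (intro exI[of _ z]) simp
qed

lemma eigenvector_off_axis_zero:
  assumes "Re \<mu> \<noteq> 0" "(z, \<mu> *\<^sub>C z) \<in> A" shows "z = 0"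
proof (cases "Re \<mu> > 0")
  case True
  then show ?thesis using eigenvector_zero assms by blast
next
  case False
  then have "0 < Re (- \<mu>)" "(z, (- \<mu>) *\<^sub>C z) \<in> generator (\<lambda>t. T (- t))"
    using assms by (auto simp: generator_reflected)
  then show ?thesis by (rule tempered_group.eigenvector_zero[OF reflected])
qed

abbreviation R :: "complex \<Rightarrow> 'a \<Rightarrow> 'a" where "R \<mu> \<equiv> resolvent \<mu> A"

lemma shift_add:
  "(x, w) \<in> shift \<mu> A \<Longrightarrow> (x', w') \<in> shift \<mu> A \<Longrightarrow> (x + x', w + w') \<in> shift \<mu> A"
  using generator_add[of x "\<mu> *\<^sub>C x - w" x' "\<mu> *\<^sub>C x' - w'"]
  by (simp add: shift_iff scaleC_add_right algebra_simps)

lemma shift_scaleC: "(x, w) \<in> shift \<mu> A \<Longrightarrow> (c *\<^sub>C x, c *\<^sub>C w) \<in> shift \<mu> A"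
  using generator_scaleC[of x "\<mu> *\<^sub>C x - w" c]
  by (simp add: shift_iff scaleC_diff_right scaleC_scaleC mult.commute)

lemma shift_diff:
  "(x, w) \<in> shift \<mu> A \<Longrightarrow> (x', w') \<in> shift \<mu> A \<Longrightarrow> (x - x', w - w') \<in> shift \<mu> A"
  using shift_add[of x w \<mu> "- x'" "- w'"] shift_scaleC[of x' w' \<mu> "-1"] by simp

lemma shift_change: "(x, w) \<in> shift \<nu> A \<Longrightarrow> (x, w + (\<mu> - \<nu>) *\<^sub>C x) \<in> shift \<mu> A"
  by (simp add: shift_iff scaleC_diff_left)

lemma shift_limit:
  assumes "\<And>k. (f (\<mu> k), x) \<in> shift (\<mu> k) A" "\<mu> \<longlonglongrightarrow> \<nu>" "isCont f \<nu>"
  shows "(f \<nu>, x) \<in> shift \<nu> A"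
  unfolding shift_iff
proof (rule generator_closed)
  show "(f (\<mu> k), \<mu> k *\<^sub>C f (\<mu> k) - x) \<in> A" for k using assms(1) by (simp add: shift_iff)
  show *: "(\<lambda>k. f (\<mu> k)) \<longlonglongrightarrow> f \<nu>" using assms(2,3) isCont_tendsto_compose by blast
  show "(\<lambda>k. \<mu> k *\<^sub>C f (\<mu> k) - x) \<longlonglongrightarrow> \<nu> *\<^sub>C f \<nu> - x"
    by (intro tendsto_intros bounded_bilinear.tendsto[OF bounded_bilinear_scaleC] assms(2) *)
qed

text \<open>As the generator is closed, the equation \<open>(\<mu> - A) f(\<mu>) = x\<close> passes to limits. It is enough to know it off
  the vertical line through \<open>\<nu>\<close>.\<close>

lemma shift_at_limit:
  assumes U: "open U" "\<nu> \<in> U" and f: "isCont f \<nu>"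
    and sol: "\<And>\<mu>. \<mu> \<in> U \<Longrightarrow> Re \<mu> \<noteq> Re \<nu> \<Longrightarrow> (f \<mu>, x) \<in> shift \<mu> A"
  shows "(f \<nu>, x) \<in> shift \<nu> A"
proof -
  obtain r where r: "r > 0" "ball \<nu> r \<subseteq> U" using U openE by blast
  define s where "s k = r / 2 * inverse (real (Suc k))" for k
  have s: "0 < s k" "s k < r" for k
  proof -
    show "0 < s k" using r(1) by (simp add: s_def)
    have "s k \<le> r / 2 * 1"
      unfolding s_def using r(1) by (intro mult_left_mono) (auto simp: field_simps)
    then show "s k < r" using r(1) by simp
  qed
  have "s \<longlonglongrightarrow> r / 2 * 0"
    unfolding s_def by (intro tendsto_mult tendsto_const LIMSEQ_inverse_real_of_nat)
  then have "(\<lambda>k. \<nu> + of_real (s k)) \<longlonglongrightarrow> \<nu> + of_real (r / 2 * 0)"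
    by (intro tendsto_add tendsto_const tendsto_of_real)
  then have "(\<lambda>k. \<nu> + of_real (s k)) \<longlonglongrightarrow> \<nu>" by simp
  moreover have "(f (\<nu> + of_real (s k)), x) \<in> shift (\<nu> + of_real (s k)) A" for k
  proof (rule sol)
    show "\<nu> + of_real (s k) \<in> U" using r(2) s[of k] by (auto simp: dist_norm)
    show "Re (\<nu> + of_real (s k)) \<noteq> Re \<nu>" using s(1)[of k] by simp
  qed
  ultimately show ?thesis using shift_limit[OF _ _ f, where \<mu> = "\<lambda>k. \<nu> + of_real (s k)"] by simp
qed

lemma resolvent_ex1: "Re \<mu> \<noteq> 0 \<Longrightarrow> \<exists>!z. (z, x) \<in> shift \<mu> A"
proof (rule ex_ex1I)
  assume \<mu>: "Re \<mu> \<noteq> 0"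
  show "\<exists>z. (z, x) \<in> shift \<mu> A" using resolvent_equation_off_axis[OF \<mu>] by (auto simp: shift_iff)
  fix z z' assume "(z, x) \<in> shift \<mu> A" "(z', x) \<in> shift \<mu> A"
  then have "(z - z', 0) \<in> shift \<mu> A" using shift_diff by fastforce
  then have "z - z' = 0" by (intro eigenvector_off_axis_zero[OF \<mu>]) (simp add: shift_iff)
  then show "z = z'" by simp
qed

lemma resolvent_solves: "Re \<mu> \<noteq> 0 \<Longrightarrow> (R \<mu> x, x) \<in> shift \<mu> A"
  unfolding resolvent_def by (rule theI'[OF resolvent_ex1])

lemma resolvent_eqI: "Re \<mu> \<noteq> 0 \<Longrightarrow> (z, x) \<in> shift \<mu> A \<Longrightarrow> R \<mu> x = z"
  using resolvent_ex1[of \<mu> x] resolvent_solves[of \<mu> x] by blast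

lemma norm_resolvent_le:
  assumes "Re \<mu> \<noteq> 0"
  shows "norm (R \<mu> x) \<le> 2 * M * min 1 \<bar>Re \<mu>\<bar> powr (- a - 1) * norm x"
proof -
  obtain z where "(z, x) \<in> shift \<mu> A" "norm z \<le> 2 * M * min 1 \<bar>Re \<mu>\<bar> powr (- a - 1) * norm x"
    using resolvent_equation_off_axis[OF assms, of x] by (auto simp: shift_iff)
  then show ?thesis using resolvent_eqI[OF assms] by simp
qed

lemma resolvent_set_off_axis: assumes "Re \<mu> \<noteq> 0" shows "\<mu> \<in> resolvent_set A"
proof -
  have scale: "R \<mu> (c *\<^sub>C x) = c *\<^sub>C R \<mu> x" for c x
    by (intro resolvent_eqI shift_scaleC resolvent_solves assms)
  have "bounded_linear (R \<mu>)"
  proof (rule bounded_linear_intro)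
    show "R \<mu> (x + y) = R \<mu> x + R \<mu> y" for x y
      by (intro resolvent_eqI shift_add resolvent_solves assms)
    show "R \<mu> (r *\<^sub>R x) = r *\<^sub>R R \<mu> x" for r x
      using scale[of "of_real r" x] by (simp add: scaleC_of_real)
    show "norm (R \<mu> x) \<le> norm x * (2 * M * min 1 \<bar>Re \<mu>\<bar> powr (- a - 1))" for x
      using norm_resolvent_le[OF assms, of x] by (simp add: mult.commute)
  qed
  then show ?thesis
    using resolvent_ex1[OF assms] scale by (simp add: resolvent_set_def bounded_clinear_def)
qed

lemma resolvent_eqI_resolvent_set: "\<mu> \<in> resolvent_set A \<Longrightarrow> (z, x) \<in> shift \<mu> A \<Longrightarrow> R \<mu> x = z"
  unfolding resolvent_set_def resolvent_def by (blast intro: the1_equality)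

text \<open>This contains the resolvent identity, as the case \<open>w = R \<nu> x\<close>, and it is the inductive step for the
  expansion of \<open>R \<mu> x\<close> when \<open>x\<close> lies in the range of a power of \<open>\<nu> - A\<close>.\<close>

lemma resolvent_shift:
  assumes "(w, x) \<in> shift \<nu> A" "Re \<mu> \<noteq> 0"
  shows "R \<mu> x = (\<nu> - \<mu>) *\<^sub>C R \<mu> w + w"
proof (rule resolvent_eqI[OF assms(2)])
  have "((\<nu> - \<mu>) *\<^sub>C R \<mu> w + w, (\<nu> - \<mu>) *\<^sub>C w + (x + (\<mu> - \<nu>) *\<^sub>C w)) \<in> shift \<mu> A"
    by (intro shift_add shift_scaleC resolvent_solves shift_change assms)
  then show "((\<nu> - \<mu>) *\<^sub>C R \<mu> w + w, x) \<in> shift \<mu> A" by (simp add: scaleC_diff_left)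
qed

text \<open>Two applications of the resolvent identity give
  \<open>R (\<nu> + h) x = R \<nu> x - h R \<nu>\<^sup>2 x + h\<^sup>2 R (\<nu> + h) R \<nu>\<^sup>2 x\<close>, and the last factor is bounded for small \<open>h\<close>.\<close>

lemma resolvent_vholomorphic: "(\<lambda>\<mu>. R \<mu> x) vholomorphic_on {\<mu>. Re \<mu> \<noteq> 0}"
proof -
  have op: "open {\<mu>. Re \<mu> \<noteq> 0}" by (intro open_Collect_neq continuous_intros)
  have "vdiff_at (\<lambda>\<mu>. R \<mu> x) \<nu>" if \<nu>: "Re \<nu> \<noteq> 0" for \<nu>
  proof -
    define w where "w = R \<nu> x"
    define v where "v = R \<nu> w"
    define r where "r = \<bar>Re \<nu>\<bar> / 2"
    define B where "B = 2 * M * min 1 r powr (- a - 1) * norm v"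
    have r: "r > 0" using \<nu> by (simp add: r_def)
    have near: "norm (norm (R (\<nu> + h) x - R \<nu> x - h *\<^sub>C (- v)) / norm h) \<le> cmod h * B"
      if h: "h \<noteq> 0" "cmod h < r" for h
    proof -
      have re: "r \<le> \<bar>Re (\<nu> + h)\<bar>" using abs_Re_le_cmod[of h] h abs_triangle_ineq4[of "Re (\<nu> + h)" "Re h"] by (simp add: r_def)
      then have re0: "Re (\<nu> + h) \<noteq> 0" using r by auto
      have step: "R (\<nu> + h) u = (- h) *\<^sub>C R (\<nu> + h) (R \<nu> u) + R \<nu> u" for u
        using resolvent_shift[OF resolvent_solves[OF \<nu>] re0, of u] by simp
      have "R (\<nu> + h) x - R \<nu> x - h *\<^sub>C (- v) = (h * h) *\<^sub>C R (\<nu> + h) v"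
        unfolding step[of x] w_def[symmetric] step[of w] v_def[symmetric]
        by (simp add: scaleC_add_right scaleC_diff_right scaleC_scaleC)
      moreover have "norm (R (\<nu> + h) v) \<le> B"
      proof -
        have "norm (R (\<nu> + h) v) \<le> 2 * M * min 1 \<bar>Re (\<nu> + h)\<bar> powr (- a - 1) * norm v"
          by (rule norm_resolvent_le[OF re0])
        also have "\<dots> \<le> B"
          unfolding B_def using re r a M
          by (intro mult_right_mono mult_left_mono powr_mono2') auto
        finally show ?thesis .
      qed
      ultimately show ?thesis using h(1) by (simp add: norm_scaleC norm_mult)
    qed
    have "((\<lambda>\<mu>. R \<mu> x) has_derivative (\<lambda>h. h *\<^sub>C (- v))) (at \<nu>)"
      unfolding has_derivative_at
    proof
      show "bounded_linear (\<lambda>h. h *\<^sub>C (- v))"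
        by (rule bounded_bilinear.bounded_linear_left[OF bounded_bilinear_scaleC])
      show "(\<lambda>h. norm (R (\<nu> + h) x - R \<nu> x - h *\<^sub>C (- v)) / norm h) \<midarrow>0\<rightarrow> 0"
      proof (rule Lim_null_comparison)
        show "\<forall>\<^sub>F h in at 0. norm (norm (R (\<nu> + h) x - R \<nu> x - h *\<^sub>C (- v)) / norm h) \<le> cmod h * B"
          unfolding eventually_at using r near by (intro exI[of _ r]) (simp add: dist_norm)
        show "((\<lambda>h. cmod h * B) \<longlongrightarrow> 0) (at 0)"
          by (rule tendsto_eq_intros | simp)+
      qed
    qed
    then show ?thesis unfolding vdiff_at_def by blast
  qed
  then show ?thesis using vholomorphic_on_open[OF op] by blast
qed

lemma power_mult_powr:
  "0 < s \<Longrightarrow> s ^ n * s powr (- a - 1) = s powr (real n - a - 1)" for s :: real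
  by (simp add: powr_realpow[symmetric] powr_add[symmetric] algebra_simps)

lemma resolvent_growth:
  assumes n: "a + 1 \<le> real n" and re: "Re \<mu> \<noteq> 0" "\<bar>Re \<mu>\<bar> \<le> 1"
  shows "\<bar>Re \<mu>\<bar> ^ n * norm (R \<mu> x) \<le> 2 * M * norm x * \<bar>Re \<mu>\<bar> powr (real n - a - 1)"
proof -
  have "\<bar>Re \<mu>\<bar> ^ n * norm (R \<mu> x) \<le> \<bar>Re \<mu>\<bar> ^ n * (2 * M * \<bar>Re \<mu>\<bar> powr (- a - 1) * norm x)"
    using norm_resolvent_le[OF re(1), of x] re by (intro mult_left_mono) (auto simp: min_def)
  also have "\<dots> = 2 * M * norm x * (\<bar>Re \<mu>\<bar> ^ n * \<bar>Re \<mu>\<bar> powr (- a - 1))" by simp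
  also have "\<dots> = 2 * M * norm x * \<bar>Re \<mu>\<bar> powr (real n - a - 1)"
    using power_mult_powr[of "\<bar>Re \<mu>\<bar>" n] re by simp
  finally show ?thesis .
qed

text \<open>If \<open>x = (\<nu> - A)^n y\<close>, writing \<open>\<nu> - A = (\<nu> - \<mu>) + (\<mu> - A)\<close> repeatedly yields a polynomial \<open>p\<close> in \<open>\<mu>\<close> and a
  single remaining resolvent, multiplied by \<open>(\<nu> - \<mu>)^n\<close>.\<close>

lemma resolvent_of_range_power:
  assumes "(y, x) \<in> shift \<nu> A ^^ n"
  obtains p where "continuous_on UNIV p"
    "\<And>\<mu>. Re \<mu> \<noteq> 0 \<Longrightarrow> R \<mu> x = (\<nu> - \<mu>) ^ n *\<^sub>C R \<mu> y + p \<mu>"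
proof -
  have "\<exists>p. continuous_on UNIV p \<and> (\<forall>\<mu>. Re \<mu> \<noteq> 0 \<longrightarrow> R \<mu> x = (\<nu> - \<mu>) ^ n *\<^sub>C R \<mu> y + p \<mu>)"
    using assms
  proof (induction n arbitrary: x)
    case 0
    then show ?case by (intro exI[of _ "\<lambda>_. 0"]) auto
  next
    case (Suc n)
    then obtain w where w: "(y, w) \<in> shift \<nu> A ^^ n" "(w, x) \<in> shift \<nu> A"
      by (auto elim: relpow_Suc_E)
    obtain p where p: "continuous_on UNIV p"
      "\<And>\<mu>. Re \<mu> \<noteq> 0 \<Longrightarrow> R \<mu> w = (\<nu> - \<mu>) ^ n *\<^sub>C R \<mu> y + p \<mu>"
      using Suc.IH[OF w(1)] by blast
    have "continuous_on UNIV (\<lambda>\<mu>. (\<nu> - \<mu>) *\<^sub>C p \<mu> + w)"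
      by (intro continuous_intros bounded_bilinear.continuous_on[OF bounded_bilinear_scaleC] p(1))
    moreover have "R \<mu> x = (\<nu> - \<mu>) ^ Suc n *\<^sub>C R \<mu> y + ((\<nu> - \<mu>) *\<^sub>C p \<mu> + w)" if "Re \<mu> \<noteq> 0" for \<mu>
      unfolding resolvent_shift[OF w(2) that] p(2)[OF that]
      by (simp add: scaleC_add_right scaleC_scaleC)
    ultimately show ?case by blast
  qed
  then show ?thesis using that by blast
qed

text \<open>Horizontally, \<open>|\<nu> - \<mu>|\<close> is the distance to the axis. So the factor \<open>(\<nu> - \<mu>)^n\<close> beats the
  growth of the resolvent, of order \<open>a + 1 < n\<close>, and the polynomial part provides the limit from either side.\<close>

lemma radial_limit_of_range_power:
  assumes n: "a + 1 < real n" and x: "x \<in> Range (shift (Complex 0 t) A ^^ n)"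
  shows "\<exists>l. ((\<lambda>e. R (Complex e t) x) \<longlongrightarrow> l) (at 0)"
proof -
  obtain y where "(y, x) \<in> shift (Complex 0 t) A ^^ n" using x by blast
  then obtain p where p: "continuous_on UNIV p"
    "\<And>\<mu>. Re \<mu> \<noteq> 0 \<Longrightarrow> R \<mu> x = (Complex 0 t - \<mu>) ^ n *\<^sub>C R \<mu> y + p \<mu>"
    using resolvent_of_range_power by blast
  have "((\<lambda>e. Complex e t) \<longlongrightarrow> Complex 0 t) (at 0)" by (intro tendsto_intros)
  then have plim: "((\<lambda>e. p (Complex e t)) \<longlongrightarrow> p (Complex 0 t)) (at 0)"
    using p(1) by (metis UNIV_I continuous_on_eq_continuous_at isCont_tendsto_compose open_UNIV)
  have "((\<lambda>e. \<bar>e::real\<bar> powr (real n - a - 1)) \<longlongrightarrow> 0) (at 0)"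
  proof (rule tendsto_zero_powrI[OF _ tendsto_const])
    show "((\<lambda>e::real. \<bar>e\<bar>) \<longlongrightarrow> 0) (at 0)" by (rule tendsto_eq_intros | simp)+
  qed (use n in auto)
  then have z: "((\<lambda>e. 2 * M * norm y * \<bar>e\<bar> powr (real n - a - 1)) \<longlongrightarrow> 0) (at 0)"
    by (rule tendsto_mult_right_zero)
  have "((\<lambda>e. R (Complex e t) x - p (Complex e t)) \<longlongrightarrow> 0) (at 0)"
  proof (rule Lim_null_comparison[OF _ z])
    have "norm (R (Complex e t) x - p (Complex e t)) \<le> 2 * M * norm y * \<bar>e\<bar> powr (real n - a - 1)"
      if e: "e \<noteq> 0" "\<bar>e\<bar> < 1" for e
    proof -
      have "Complex 0 t - Complex e t = of_real (- e)" by (simp add: complex_eq_iff)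
      then have "norm (R (Complex e t) x - p (Complex e t)) = \<bar>e\<bar> ^ n * norm (R (Complex e t) y)"
        using p(2)[of "Complex e t"] e(1) by (simp only: norm_scaleC norm_power norm_of_real) (simp add: norm_scaleC norm_power)
      then show ?thesis using resolvent_growth[of n "Complex e t" y] n e by simp
    qed
    then show "\<forall>\<^sub>F e in at 0. norm (R (Complex e t) x - p (Complex e t)) \<le>
        2 * M * norm y * \<bar>e\<bar> powr (real n - a - 1)"
      unfolding eventually_at by (intro exI[of _ 1]) (simp add: dist_real_def)
  qed
  from tendsto_add[OF this plim] show ?thesis by auto
qed

text \<open>The extension of a local resolvent is not only holomorphic: it solves the resolvent equation also on the
  axis. Therefore it agrees with the resolvent at those points of the axis that belong to the resolvent set.\<close>

lemma solves_if_extends_resolvent: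
  assumes U: "open U" and f: "f vholomorphic_on U"
    and ext: "\<And>\<mu>. \<mu> \<in> U \<Longrightarrow> Re \<mu> \<noteq> 0 \<Longrightarrow> f \<mu> = R \<mu> x" and \<nu>: "\<nu> \<in> U"
  shows "(f \<nu>, x) \<in> shift \<nu> A"
proof (cases "Re \<nu> = 0")
  case False
  then show ?thesis using ext[OF \<nu>] resolvent_solves by simp
next
  case True
  have "isCont f \<nu>"
    using f \<nu> vholomorphic_on_open[OF U] vdiff_at_imp_continuous by blast
  then show ?thesis
    by (rule shift_at_limit[OF U \<nu>]) (use True ext resolvent_solves in simp)
qed

text \<open>By the radial limits at all points outside \<open>F\<close>, the local resolvent extends holomorphically across
  the whole complement of \<open>iF\<close>. The extension is defined on the axis as the radial limit, with an
  arbitrary value over \<open>F\<close>.\<close>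

lemma range_powers_subset_spectral_subspace:
  assumes F: "closed F" and n: "a + 1 < real n"
    and x: "\<And>t. t \<notin> F \<Longrightarrow> x \<in> Range (shift (Complex 0 t) A ^^ n)"
  shows "x \<in> spectral_subspace A F"
proof -
  have n0: "0 < n" using n a by (cases n) auto
  define g where "g \<mu> = (if Re \<mu> \<noteq> 0 then R \<mu> x else
      SOME l. ((\<lambda>e. R (Complex e (Im \<mu>)) x) \<longlongrightarrow> l) (at 0))" for \<mu>
  define U where "U = {\<mu>. Re \<mu> \<noteq> 0 \<or> Im \<mu> \<in> - F}"
  have g: "g vholomorphic_on U"
    unfolding U_def
  proof (rule vholomorphic_across_axis[where n = n and M = "2 * M * norm x"])
    show "g vholomorphic_on {\<mu>. Re \<mu> \<noteq> 0}"
      unfolding vholomorphic_on_def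
    proof
      fix \<nu> assume \<nu>: "\<nu> \<in> {\<mu>. Re \<mu> \<noteq> 0}"
      then obtain D where "((\<lambda>\<mu>. R \<mu> x) has_derivative (\<lambda>h. h *\<^sub>C D)) (at \<nu> within {\<mu>. Re \<mu> \<noteq> 0})"
        using resolvent_vholomorphic[of x] unfolding vholomorphic_on_def by blast
      then have "(g has_derivative (\<lambda>h. h *\<^sub>C D)) (at \<nu> within {\<mu>. Re \<mu> \<noteq> 0})"
        by (rule has_derivative_transform[OF \<nu>, rotated]) (simp add: g_def)
      then show "\<exists>D. (g has_derivative (\<lambda>h. h *\<^sub>C D)) (at \<nu> within {\<mu>. Re \<mu> \<noteq> 0})" by blast
    qed
    show "\<bar>Re \<mu>\<bar> ^ n * norm (g \<mu>) \<le> 2 * M * norm x" if "\<bar>Re \<mu>\<bar> \<le> 1" for \<mu>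
    proof (cases "Re \<mu> = 0")
      case True
      then show ?thesis using n0 M by (simp add: zero_power)
    next
      case False
      have "\<bar>Re \<mu>\<bar> ^ n * norm (R \<mu> x) \<le> 2 * M * norm x * \<bar>Re \<mu>\<bar> powr (real n - a - 1)"
        using n False that by (intro resolvent_growth) auto
      also have "\<dots> \<le> 2 * M * norm x * 1"
        using M n False that by (intro mult_left_mono powr_le1) auto
      finally show ?thesis using False by (simp add: g_def)
    qed
    show "open (- F)" using F by (rule open_Compl)
    show "((\<lambda>e. g (Complex e t)) \<longlongrightarrow> g (Complex 0 t)) (at 0)" if t: "t \<in> - F" for t
    proof -
      have "((\<lambda>e. R (Complex e t) x) \<longlongrightarrow> g (Complex 0 t)) (at 0)"
        using someI_ex[OF radial_limit_of_range_power[OF n x]] t by (simp add: g_def)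
      moreover have "((\<lambda>e. R (Complex e t) x) \<longlongrightarrow> l) (at 0) \<longleftrightarrow> ((\<lambda>e. g (Complex e t)) \<longlongrightarrow> l) (at 0)" for l
        by (intro LIM_equal) (simp add: g_def)
      ultimately show ?thesis by simp
    qed
  qed (rule n0)
  have oU: "open U" unfolding U_def by (rule open_off_axis_or_Im_in[OF open_Compl[OF F]])
  have "(g \<mu>, x) \<in> shift \<mu> A" if "\<mu> \<in> U" for \<mu>
    by (rule solves_if_extends_resolvent[OF oU g _ that]) (simp add: g_def)
  then have "\<forall>\<mu>\<in>U \<inter> resolvent_set A. g \<mu> = R \<mu> x"
    using resolvent_eqI_resolvent_set by force
  then have "U \<subseteq> - local_spectrum A x" unfolding local_spectrum_def using g oU by blast
  moreover have "- U \<subseteq> (\<lambda>t. \<i> * complex_of_real t) ` F"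
  proof
    fix \<mu> assume "\<mu> \<in> - U"
    then have "\<mu> = \<i> * complex_of_real (Im \<mu>)" "Im \<mu> \<in> F" by (auto simp: U_def complex_eq_iff)
    then show "\<mu> \<in> (\<lambda>t. \<i> * complex_of_real t) ` F" by blast
  qed
  ultimately show ?thesis unfolding spectral_subspace_def by blast
qed

text \<open>The vector-valued removable singularity theorem for difference quotients: each functional reduces it to
  the scalar theorem, and continuity supplies the local bounds.\<close>

lemma difference_quotient_vholomorphic:
  fixes f :: "complex \<Rightarrow> 'a"
  assumes U: "open U" "\<nu> \<in> U" and f: "f vholomorphic_on U"
  obtains h where "h vholomorphic_on U"
    "\<And>\<mu>. \<mu> \<noteq> \<nu> \<Longrightarrow> h \<mu> = inverse (\<mu> - \<nu>) *\<^sub>C (f \<mu> - f \<nu>)"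
proof -
  obtain D where D: "(f has_derivative (\<lambda>h. h *\<^sub>C D)) (at \<nu>)"
    using f U vholomorphic_on_open[OF U(1)] by (auto simp: vdiff_at_def)
  define h where "h \<mu> = (if \<mu> = \<nu> then D else inverse (\<mu> - \<nu>) *\<^sub>C (f \<mu> - f \<nu>))" for \<mu>
  have cf: "isCont f \<mu>" if "\<mu> \<in> U" for \<mu>
    using f that vholomorphic_on_open[OF U(1)] vdiff_at_imp_continuous by blast
  have ch: "isCont h \<mu>" if \<mu>: "\<mu> \<in> U" for \<mu>
  proof (cases "\<mu> = \<nu>")
    case True
    have "norm (h (\<nu> + k) - D) = norm (f (\<nu> + k) - f \<nu> - k *\<^sub>C D) / norm k" if "k \<noteq> 0" for k
    proof -
      have "h (\<nu> + k) - D = inverse k *\<^sub>C (f (\<nu> + k) - f \<nu> - k *\<^sub>C D)"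
        using that by (simp add: h_def scaleC_diff_right scaleC_scaleC)
      then show ?thesis by (simp add: norm_scaleC norm_inverse divide_inverse mult.commute)
    qed
    then have "((\<lambda>k. norm (h (\<nu> + k) - D)) \<longlongrightarrow> 0) (at 0) \<longleftrightarrow>
        ((\<lambda>k. norm (f (\<nu> + k) - f \<nu> - k *\<^sub>C D) / norm k) \<longlongrightarrow> 0) (at 0)"
      by (intro LIM_equal) simp
    then have "((\<lambda>k. h (\<nu> + k)) \<longlongrightarrow> D) (at 0)"
      using D unfolding has_derivative_at by (simp add: LIM_zero_iff tendsto_norm_zero_iff)
    then show ?thesis unfolding True isCont_iff by (simp add: h_def)
  next
    case False
    have "isCont (\<lambda>\<mu>. inverse (\<mu> - \<nu>) *\<^sub>C (f \<mu> - f \<nu>)) \<mu>"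
      using False cf[OF \<mu>]
      by (intro bounded_bilinear.isCont[OF bounded_bilinear_scaleC] continuous_intros) auto
    moreover have "\<forall>\<^sub>F \<mu>' in nhds \<mu>. \<mu>' \<in> - {\<nu>}"
      using False by (intro eventually_nhds_in_open) auto
    then have "\<forall>\<^sub>F \<mu>' in nhds \<mu>. h \<mu>' = inverse (\<mu>' - \<nu>) *\<^sub>C (f \<mu>' - f \<nu>)"
      by (rule eventually_mono) (simp add: h_def)
    ultimately show ?thesis using isCont_cong by metis
  qed
  have "h vholomorphic_on U"
  proof (rule weakly_holomorphic_imp_vholomorphic[OF U(1)])
    fix z assume "z \<in> U"
    then obtain r where "r > 0" "\<And>w. dist w z < r \<Longrightarrow> dist (h w) (h z) < 1"
      using ch[of z] unfolding continuous_at_eps_delta by (meson zero_less_one)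
    then have "norm (h w) \<le> norm (h z) + 1" if "w \<in> ball z r" for w
      using that norm_triangle_ineq2[of "h w" "h z"] by (fastforce simp: dist_norm norm_minus_commute)
    then show "\<exists>r>0. \<exists>B. \<forall>w\<in>ball z r. norm (h w) \<le> B" using \<open>r > 0\<close> by blast
  next
    fix \<phi> :: "'a \<Rightarrow> complex" assume \<phi>: "contractive_functional \<phi>"
    note lin = linear_diff[OF bounded_linear.linear[OF contractive_functional_bounded_linear[OF \<phi>]]]
    have "deriv (\<lambda>z. \<phi> (f z)) \<nu> = \<phi> D"
      using functional_has_field_derivative[OF D \<phi>] by (rule DERIV_imp_deriv)
    then have "(\<lambda>z. \<phi> (h z)) = (\<lambda>z. if z = \<nu> then deriv (\<lambda>z. \<phi> (f z)) \<nu>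
        else (\<phi> (f z) - \<phi> (f \<nu>)) / (z - \<nu>))"
      by (auto simp: h_def contractive_functional_scaleC[OF \<phi>] lin divide_inverse mult.commute)
    then show "(\<lambda>z. \<phi> (h z)) holomorphic_on U"
      using pole_lemma[OF vholomorphic_imp_functional_holomorphic[OF f \<phi>], of \<nu>] U
      by (simp add: interior_open)
  qed
  then show ?thesis using that[of h] by (simp add: h_def)
qed

text \<open>If \<open>(\<mu> - A) f(\<mu>) = x\<close> near \<open>\<nu>\<close>, then \<open>x = (\<nu> - A) f(\<nu>)\<close>, and \<open>f(\<nu>)\<close> is of the same kind as \<open>x\<close>: minus the
  difference quotient of \<open>f\<close> at \<open>\<nu>\<close> solves the equation with right-hand side \<open>f(\<nu>)\<close>. So \<open>x\<close> can be divided by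
  \<open>\<nu> - A\<close> as often as desired.\<close>

lemma range_power_if_solution:
  assumes U: "open U" "\<nu> \<in> U"
    and f: "f vholomorphic_on U" and sol: "\<And>\<mu>. \<mu> \<in> U \<Longrightarrow> (f \<mu>, x) \<in> shift \<mu> A"
  shows "x \<in> Range (shift \<nu> A ^^ n)"
  using f sol
proof (induction n arbitrary: f x)
  case 0
  then show ?case by auto
next
  case (Suc n)
  obtain h where h: "h vholomorphic_on U"
    "\<And>\<mu>. \<mu> \<noteq> \<nu> \<Longrightarrow> h \<mu> = inverse (\<mu> - \<nu>) *\<^sub>C (f \<mu> - f \<nu>)"
    using difference_quotient_vholomorphic[OF U Suc.prems(1)] by blast
  have off: "(h \<mu>, - f \<nu>) \<in> shift \<mu> A" if \<mu>: "\<mu> \<in> U" "\<mu> \<noteq> \<nu>" for \<mu>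
  proof -
    have "(f \<mu> - f \<nu>, x - (x + (\<mu> - \<nu>) *\<^sub>C f \<nu>)) \<in> shift \<mu> A"
      by (intro shift_diff shift_change Suc.prems(2) \<mu> U)
    then have "(inverse (\<mu> - \<nu>) *\<^sub>C (f \<mu> - f \<nu>), inverse (\<mu> - \<nu>) *\<^sub>C (x - (x + (\<mu> - \<nu>) *\<^sub>C f \<nu>)))
        \<in> shift \<mu> A" by (rule shift_scaleC)
    then show ?thesis using \<mu>(2) h(2) by (simp add: scaleC_scaleC)
  qed
  have sol: "(h \<mu>, - f \<nu>) \<in> shift \<mu> A" if "\<mu> \<in> U" for \<mu>
  proof (cases "\<mu> = \<nu>")
    case True
    have "isCont h \<nu>"
      using h(1) U vholomorphic_on_open[OF U(1)] vdiff_at_imp_continuous by blast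
    then have "(h \<nu>, - f \<nu>) \<in> shift \<nu> A"
      by (rule shift_at_limit[OF U]) (use off in auto)
    then show ?thesis using True by simp
  qed (use off that in blast)
  have "(\<lambda>\<mu>. - h \<mu>) vholomorphic_on U" using h(1) by (rule vholomorphic_on_minus)
  moreover have "(- h \<mu>, f \<nu>) \<in> shift \<mu> A" if "\<mu> \<in> U" for \<mu>
    using shift_scaleC[OF sol[OF that], of "-1"] by simp
  ultimately have "f \<nu> \<in> Range (shift \<nu> A ^^ n)" by (rule Suc.IH)
  then show ?case using Suc.prems(2)[OF U(2)] by auto
qed

lemma spectral_subspace_subset_range_power:
  assumes x: "x \<in> spectral_subspace A F" and t: "t \<notin> F"
  shows "x \<in> Range (shift (\<i> * complex_of_real t) A ^^ n)"
proof -
  let ?\<nu> = "\<i> * complex_of_real t"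
  have "?\<nu> \<notin> local_spectrum A x" using x t unfolding spectral_subspace_def by auto
  then obtain U f where U: "open U" "?\<nu> \<in> U" and f: "f vholomorphic_on U"
    and ext: "\<forall>\<mu>\<in>U \<inter> resolvent_set A. f \<mu> = R \<mu> x"
    unfolding local_spectrum_def by blast
  have "(f \<mu>, x) \<in> shift \<mu> A" if "\<mu> \<in> U" for \<mu>
    using solves_if_extends_resolvent[OF U(1) f _ that] ext resolvent_set_off_axis by blast
  then show ?thesis by (rule range_power_if_solution[OF U f])
qed

text \<open>What matters about \<open>n\<close> is that it exceeds the growth exponent \<open>a + 1\<close> of the resolvent at the axis;
  \<open>n = 2\<close> and \<open>n = 3\<close> are the smallest such integers for \<open>a < 1\<close> and for \<open>1 \<le> a < 2\<close>.\<close>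

theorem spectral_subspace_eq_Inter_ranges:
  assumes "closed F" "a + 1 < real n"
  shows "spectral_subspace A F = (\<Inter>t\<in>UNIV - F. Range (shift (\<i> * complex_of_real t) A ^^ n))"
proof
  show "spectral_subspace A F \<subseteq> (\<Inter>t\<in>UNIV - F. Range (shift (\<i> * complex_of_real t) A ^^ n))"
    using spectral_subspace_subset_range_power by blast
  show "(\<Inter>t\<in>UNIV - F. Range (shift (\<i> * complex_of_real t) A ^^ n)) \<subseteq> spectral_subspace A F"
  proof
    fix x assume x: "x \<in> (\<Inter>t\<in>UNIV - F. Range (shift (\<i> * complex_of_real t) A ^^ n))"
    show "x \<in> spectral_subspace A F"
    proof (rule range_powers_subset_spectral_subspace[OF assms])
      fix t assume "t \<notin> F"
      moreover have "\<i> * complex_of_real t = Complex 0 t" by (simp add: complex_eq_iff)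
      ultimately show "x \<in> Range (shift (Complex 0 t) A ^^ n)" using x by (metis DiffI INT_iff UNIV_I)
    qed
  qed
qed

end

text \<open>With \<open>s = \<epsilon> |t|\<close> the claim becomes \<open>1 + s^a \<le> 8 exp (s / 2)\<close>, which holds since \<open>s^a \<le> 1 + s\<^sup>2\<close> for
  \<open>a \<le> 2\<close> and \<open>exp (s / 2) \<ge> 1 + s / 2 + s\<^sup>2 / 8\<close>.\<close>

lemma polynomial_growth_imp_tempered:
  assumes T: "C0_group T" and a: "0 \<le> a" "a < 2"
    and C: "\<And>t. onorm (T t) \<le> C * (1 + \<bar>t\<bar> powr a)"
  shows "tempered_group T (8 * \<bar>C\<bar>) a"
proof
  fix \<epsilon> t :: real and x :: 'a
  assume \<epsilon>: "0 < \<epsilon>" "\<epsilon> \<le> 1"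
  define s where "s = \<epsilon> * \<bar>t\<bar>"
  have s: "0 \<le> s" using \<epsilon> by (simp add: s_def)
  have "s powr a \<le> 1 + s\<^sup>2"
  proof (cases "s \<le> 1")
    case True
    then have "s powr a \<le> 1" using s a by (simp add: powr_le1)
    then show ?thesis using zero_le_power2[of s] by linarith
  next
    case False
    then have "s powr a \<le> s powr 2" using a by (intro powr_mono) auto
    then show ?thesis using False by simp
  qed
  moreover have "8 + s\<^sup>2 \<le> 8 * exp (s / 2)"
    using exp_lower_Taylor_quadratic[of "s / 2"] s by (simp add: power_divide)
  ultimately have poly: "1 + s powr a \<le> 8 * exp (s / 2)" by linarith
  have one: "1 \<le> \<epsilon> powr (- a)" using \<epsilon> a powr_mono2'[of "- a" \<epsilon> 1] by simp
  have "\<bar>t\<bar> = s / \<epsilon>" using \<epsilon> by (simp add: s_def)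
  then have tp: "\<bar>t\<bar> powr a = \<epsilon> powr (- a) * s powr a"
    using s \<epsilon> by (simp add: powr_divide powr_minus_divide)
  have "onorm (T t) \<le> C * (1 + \<bar>t\<bar> powr a)" by (rule C)
  also have "\<dots> \<le> \<bar>C\<bar> * (1 + \<bar>t\<bar> powr a)" by (intro mult_right_mono) auto
  also have "\<dots> \<le> \<bar>C\<bar> * (\<epsilon> powr (- a) * (1 + s powr a))"
    using one tp by (intro mult_left_mono) (auto simp: algebra_simps)
  also have "\<dots> \<le> \<bar>C\<bar> * (\<epsilon> powr (- a) * (8 * exp (s / 2)))"
    using poly by (intro mult_left_mono) auto
  finally have on: "onorm (T t) \<le> 8 * \<bar>C\<bar> * \<epsilon> powr (- a) * exp (\<epsilon> * \<bar>t\<bar> / 2)" by (simp add: s_def)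
  have "bounded_linear (T t)" using T by (simp add: C0_group_def bounded_clinear_def)
  then have "norm (T t x) \<le> onorm (T t) * norm x" by (rule onorm)
  also have "\<dots> \<le> 8 * \<bar>C\<bar> * \<epsilon> powr (- a) * exp (\<epsilon> * \<bar>t\<bar> / 2) * norm x"
    using on by (rule mult_right_mono) simp
  finally show "norm (T t x) \<le> 8 * \<bar>C\<bar> * \<epsilon> powr (- a) * exp (\<epsilon> * \<bar>t\<bar> / 2) * norm x" .
qed (use T a in auto)

theorem theorem1p6:
  fixes T :: "real \<Rightarrow> 'a::complex_banach \<Rightarrow> 'a"
    and A :: "('a \<times> 'a) set"
    and a :: real
  assumes "C0_group T"
    and "A = generator T"
    and "\<exists>C::real. \<forall>t. onorm (T t) \<le> C * (1 + \<bar>t\<bar> powr a)"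
  shows "(a \<in> {0..<1} \<longrightarrow> (\<forall>F::real set. closed F \<longrightarrow>
            spectral_subspace A F =
              (\<Inter>\<beta>\<in>UNIV - F. Range (shift (\<i> * complex_of_real \<beta>) A ^^ 2)))) \<and>
         (a \<in> {1..<2} \<longrightarrow> (\<forall>F::real set. closed F \<longrightarrow>
            spectral_subspace A F =
              (\<Inter>\<beta>\<in>UNIV - F. Range (shift (\<i> * complex_of_real \<beta>) A ^^ 3))))"
proof -
  have eq: "spectral_subspace A F = (\<Inter>\<beta>\<in>UNIV - F. Range (shift (\<i> * complex_of_real \<beta>) A ^^ n))"
    if "0 \<le> a" "a < 2" "closed F" "a + 1 < real n" for F n
  proof -
    obtain C where "\<And>t. onorm (T t) \<le> C * (1 + \<bar>t\<bar> powr a)" using assms(3) by blast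
    then have "tempered_group T (8 * \<bar>C\<bar>) a"
      using polynomial_growth_imp_tempered[OF assms(1)] that by blast
    from tempered_group.spectral_subspace_eq_Inter_ranges[OF this that(3,4)]
    show ?thesis unfolding assms(2) .
  qed
  show ?thesis using eq[where n = 2] eq[where n = 3] by simp
qed

end
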